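(* Let $\{\Sigma_{(d)}\}_{d\ge1}$ be symmetric positive definite $d\times d$ matrices, $\Omega_{(d)}=\Sigma_{(d)}^{-1}$, satisfying the assumption below, and let $l>0$, $h=ld^{-1/2}$. For the RWM kernels targeting $\mathcal{N}_d(0,\Sigma_{(d)})$ with step size $h$, and for all $(x_1,y_1,v_1)\in\mathcal{S}$, the limit $$\lim_{d\to\infty}\sup_{\widetilde K\in\mathcal{I}}\mathbb{E}\Big[h^2Z_x^\top Z_yB_xB_y\ \Big|\ \tfrac{\lVert X_t\rVert^2_{\Omega_{(d)}^2}}{z_1^2d}=x_1,\ \tfrac{\lVert Y_t\rVert^2_{\Omega_{(d)}^2}}{z_1^2d}=y_1,\ \tfrac{\langle X_t,Y_t\rangle_{\Omega_{(d)}^2}}{z_1^2d}=v_1\Big]$$ is attained by the GCRN coupling, i.e. it equals the $d\to\infty$ limit of the same conditional expectation under the GCRN coupling.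
   Context: Notation: $\lVert x\rVert_A^2=x^\top Ax$, $\langle x,y\rangle_A=x^\top Ay$. Assumption: for $Z_{(d)}\sim\mathcal{N}_d(0,I_d)$ and each $k\in\mathbb{Z}$, $z_k^2=\lim_{d\to\infty}\lVert Z_{(d)}\rVert^2_{\Omega_{(d)}^k}/d$ exists in $L_2$ and $z_k\in(0,\infty)$. RWM updates: $X_{t+1}=X_t+hZ_xB_x$, $Y_{t+1}=Y_t+hZ_yB_y$ with $B_x=\mathbb{1}\{U_x\le\exp(-h\langle X_t,Z_x\rangle_{\Omega_{(d)}}-h^2\lVert Z_x\rVert^2_{\Omega_{(d)}}/2)\}$, analogously $B_y$; marginally $Z_x,Z_y\sim\mathcal{N}_d(0,I_d)$, $U_x,U_y\sim\mathrm{Unif}(0,1)$, $U_x$ independent of $Z_x$, $U_y$ independent of $Z_y$. A Markovian coupling couples $(U_x,Z_x)$ and $(U_y,Z_y)$ conditionally on $(X_t,Y_t)$; $\mathcal{I}$ is the class of such couplings in which $(U_x,U_y)$ is independent of $(Z_x,Z_y)$. GCRN coupling: $U_y=U_x$, $Z_x=Z-(n_x^\top Z)n_x+Z_1n_x$, $Z_y=Z-(n_y^\top Z)n_y+Z_1n_y$, with $n_x=-\Omega_{(d)}X_t/\lVert\Omega_{(d)}X_t\rVert$, $n_y=-\Omega_{(d)}Y_t/\lVert\Omega_{(d)}Y_t\rVert$, $Z\sim\mathcal{N}_d(0,I_d)$, $Z_1\sim\mathcal{N}(0,1)$ independent. $\mathcal{S}=\{(x,y,v):x,y\ge0,|v|\le\sqrt{xy}\}$.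 *)

theory Defs
  imports "HOL-Probability.Probability"
begin

text \<open>Vectors in R^d are functions nat => real (only indices < d matter);
  d x d matrices are functions nat => nat => real (only indices < d matter).\<close>

definition qform :: "nat \<Rightarrow> (nat \<Rightarrow> nat \<Rightarrow> real) \<Rightarrow> (nat \<Rightarrow> real) \<Rightarrow> (nat \<Rightarrow> real) \<Rightarrow> real" where
  "qform d A x y = (\<Sum>i<d. \<Sum>j<d. x i * A i j * y j)"

definition dotd :: "nat \<Rightarrow> (nat \<Rightarrow> real) \<Rightarrow> (nat \<Rightarrow> real) \<Rightarrow> real" where
  "dotd d x y = (\<Sum>i<d. x i * y i)"

definition vnorm :: "nat \<Rightarrow> (nat \<Rightarrow> real) \<Rightarrow> real" where
  "vnorm d x = sqrt (dotd d x x)"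

definition mvec :: "nat \<Rightarrow> (nat \<Rightarrow> nat \<Rightarrow> real) \<Rightarrow> (nat \<Rightarrow> real) \<Rightarrow> (nat \<Rightarrow> real)" where
  "mvec d A x = (\<lambda>i. \<Sum>j<d. A i j * x j)"

definition mmul :: "nat \<Rightarrow> (nat \<Rightarrow> nat \<Rightarrow> real) \<Rightarrow> (nat \<Rightarrow> nat \<Rightarrow> real) \<Rightarrow> (nat \<Rightarrow> nat \<Rightarrow> real)" where
  "mmul d A B = (\<lambda>i j. \<Sum>k<d. A i k * B k j)"

definition idmat :: "nat \<Rightarrow> nat \<Rightarrow> real" where
  "idmat = (\<lambda>i j. if i = j then 1 else 0)"

fun mpow :: "nat \<Rightarrow> (nat \<Rightarrow> nat \<Rightarrow> real) \<Rightarrow> nat \<Rightarrow> (nat \<Rightarrow> nat \<Rightarrow> real)" where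
  "mpow d A 0 = idmat"
| "mpow d A (Suc n) = mmul d A (mpow d A n)"

text \<open>Integer powers of Omega = Sigma^{-1}: Omega^k for k >= 0, Sigma^{-k} for k < 0.\<close>
definition mpowi :: "nat \<Rightarrow> (nat \<Rightarrow> nat \<Rightarrow> real) \<Rightarrow> (nat \<Rightarrow> nat \<Rightarrow> real) \<Rightarrow> int \<Rightarrow> (nat \<Rightarrow> nat \<Rightarrow> real)" where
  "mpowi d Sig Om k = (if 0 \<le> k then mpow d Om (nat k) else mpow d Sig (nat (- k)))"

definition sym_pos_def_mat :: "nat \<Rightarrow> (nat \<Rightarrow> nat \<Rightarrow> real) \<Rightarrow> bool" where
  "sym_pos_def_mat d A \<longleftrightarrow> (\<forall>i<d. \<forall>j<d. A i j = A j i) \<and>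
     (\<forall>v. (\<exists>i<d. v i \<noteq> 0) \<longrightarrow> qform d A v v > 0)"

definition inverse_mat :: "nat \<Rightarrow> (nat \<Rightarrow> nat \<Rightarrow> real) \<Rightarrow> (nat \<Rightarrow> nat \<Rightarrow> real) \<Rightarrow> bool" where
  "inverse_mat d A B \<longleftrightarrow> (\<forall>i<d. \<forall>j<d. mmul d A B i j = idmat i j \<and> mmul d B A i j = idmat i j)"

definition std_normal :: "real measure" where
  "std_normal = density lborel std_normal_density"

definition gaussd :: "nat \<Rightarrow> (nat \<Rightarrow> real) measure" where
  "gaussd d = PiM {..<d} (\<lambda>_. std_normal)"

definition unif01 :: "real measure" where
  "unif01 = uniform_measure lborel {0..1}"

text \<open>Sample space of one coupled step: ((U_x,U_y),(Z_x,Z_y)).\<close>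
definition MU :: "(real \<times> real) measure" where
  "MU = borel \<Otimes>\<^sub>M borel"

definition MZ :: "nat \<Rightarrow> ((nat \<Rightarrow> real) \<times> (nat \<Rightarrow> real)) measure" where
  "MZ d = gaussd d \<Otimes>\<^sub>M gaussd d"

text \<open>The class I of (Markovian, at a fixed current state) couplings: probability
  measures on ((U_x,U_y),(Z_x,Z_y)) with the correct marginals and
  (U_x,U_y) independent of (Z_x,Z_y) (which implies U_x indep. Z_x, U_y indep. Z_y).\<close>
definition couplings_I :: "nat \<Rightarrow> ((real \<times> real) \<times> ((nat \<Rightarrow> real) \<times> (nat \<Rightarrow> real))) measure set" where
  "couplings_I d = {K. sets K = sets (MU \<Otimes>\<^sub>M MZ d) \<and> prob_space K \<and>
      distr K borel (\<lambda>w. fst (fst w)) = unif01 \<and>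
      distr K borel (\<lambda>w. snd (fst w)) = unif01 \<and>
      distr K (gaussd d) (\<lambda>w. fst (snd w)) = gaussd d \<and>
      distr K (gaussd d) (\<lambda>w. snd (snd w)) = gaussd d \<and>
      K = (distr K MU fst \<Otimes>\<^sub>M distr K (MZ d) snd)}"

text \<open>Acceptance indicator B for the RWM targeting N_d(0, Omega^{-1}) at current state x.\<close>
definition accept :: "nat \<Rightarrow> (nat \<Rightarrow> nat \<Rightarrow> real) \<Rightarrow> real \<Rightarrow> (nat \<Rightarrow> real) \<Rightarrow> real \<Rightarrow> (nat \<Rightarrow> real) \<Rightarrow> real" where
  "accept d Om h x u z =
     (if u \<le> exp (- h * qform d Om x z - h\<^sup>2 * qform d Om z z / 2) then 1 else 0)"

definition cross_incr :: "nat \<Rightarrow> (nat \<Rightarrow> nat \<Rightarrow> real) \<Rightarrow> real \<Rightarrow> (nat \<Rightarrow> real) \<Rightarrow> (nat \<Rightarrow> real)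
     \<Rightarrow> (real \<times> real) \<times> ((nat \<Rightarrow> real) \<times> (nat \<Rightarrow> real)) \<Rightarrow> real" where
  "cross_incr d Om h x y w = (case w of ((ux, uy), (zx, zy)) \<Rightarrow>
       h\<^sup>2 * dotd d zx zy * accept d Om h x ux zx * accept d Om h y uy zy)"

definition nvec :: "nat \<Rightarrow> (nat \<Rightarrow> nat \<Rightarrow> real) \<Rightarrow> (nat \<Rightarrow> real) \<Rightarrow> (nat \<Rightarrow> real)" where
  "nvec d Om x = (\<lambda>i. - mvec d Om x i / vnorm d (mvec d Om x))"

definition gcrn_z :: "nat \<Rightarrow> (nat \<Rightarrow> real) \<Rightarrow> (nat \<Rightarrow> real) \<Rightarrow> real \<Rightarrow> (nat \<Rightarrow> real)" where
  "gcrn_z d n z z1 = (\<lambda>i. if i < d then z i - dotd d n z * n i + z1 * n i else undefined)"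

definition gcrn_coupling :: "nat \<Rightarrow> (nat \<Rightarrow> nat \<Rightarrow> real) \<Rightarrow> (nat \<Rightarrow> real) \<Rightarrow> (nat \<Rightarrow> real)
     \<Rightarrow> ((real \<times> real) \<times> ((nat \<Rightarrow> real) \<times> (nat \<Rightarrow> real))) measure" where
  "gcrn_coupling d Om x y =
     distr (unif01 \<Otimes>\<^sub>M (std_normal \<Otimes>\<^sub>M gaussd d)) (MU \<Otimes>\<^sub>M MZ d)
       (\<lambda>(u, z1, z). ((u, u), (gcrn_z d (nvec d Om x) z z1, gcrn_z d (nvec d Om y) z z1)))"

end

theory Submission
  imports Defs
begin

text \<open>
  Writing \<open>h\<^sup>2 z\<^sub>x \<bullet> z\<^sub>y = h\<^sup>2 (|z\<^sub>x|\<^sup>2 + |z\<^sub>y|\<^sup>2 - |z\<^sub>x - z\<^sub>y|\<^sup>2) / 2\<close>, the norms concentrate in \<open>L\<^sub>2\<close>,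
  so up to an error that does not depend on the coupling the objective is at most
  \<open>l\<^sup>2 z\<^sub>0\<^sup>2\<close> times the probability that both proposals are accepted. As the uniforms are
  independent of the proposals, that probability is at most the expected minimum of the two
  acceptance probabilities, and these are, up to a second concentration error, one increasing
  function of \<open>l z\<^sub>1 sqrt x\<^sub>1 G\<^sub>x\<close> and of \<open>l z\<^sub>1 sqrt y\<^sub>1 G\<^sub>y\<close> with standard normal \<open>G\<^sub>x, G\<^sub>y\<close>.
  The expected minimum is largest when \<open>G\<^sub>x = G\<^sub>y\<close>. The GCRN coupling has \<open>G\<^sub>x = G\<^sub>y = Z\<^sub>1\<close> and
  equal uniforms, and its proposals differ only by a vector of bounded second moment, so both
  inequalities become equalities in the limit.
\<close>

section \<open>Gaussian measure in coordinates\<close>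

text \<open>Nothing is known about the joint law of the two proposals under a general coupling, so a
  bound uniform over the class may only use expectations under one marginal. This shapes every
  estimate: polarization trades the inner product for norms of single proposals plus a term of known
  sign; the slope bound 1 for \<open>min 1 (exp r)\<close> trades the quadratic part of the
  acceptance exponent for the constant \<open>l^2 z_1^2 / 2\<close> at an \<open>L_1\<close> cost
  per proposal; the comonotone bound separates the two linear parts before their laws are used. For
  every \<open>d\<close> with the prescribed state, \<open>h\<close> times the gradient norm is
  exactly \<open>l z_1 sqrt x_1\<close> or \<open>l z_1 sqrt y_1\<close>, so the linear parts have
  the same normal laws in all these dimensions. That the GCRN proposals have the right marginals
  follows from one orthogonal reflection of \<open>R^(1+d)\<close>, which also yields the law of
  every linear form.\<close>

lemma sets_std_normal [measurable_cong, simp]: "sets std_normal = sets borel"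
  by (simp add: std_normal_def)

lemma space_std_normal [simp]: "space std_normal = UNIV"
  by (simp add: std_normal_def)

lemma prob_space_std_normal [simp, intro]: "prob_space std_normal"
  unfolding std_normal_def by (rule prob_space_normal_density) simp

lemma prob_space_gaussd [simp, intro]: "prob_space (gaussd d)"
  unfolding gaussd_def by (rule prob_space_PiM) simp

lemma sets_gaussd [measurable_cong]: "sets (gaussd d) = sets (Pi\<^sub>M {..<d} (\<lambda>_. borel))"
  unfolding gaussd_def by (rule sets_PiM_cong) auto

lemma space_gaussd: "space (gaussd d) = (\<Pi>\<^sub>E i\<in>{..<d}. UNIV)"
  unfolding gaussd_def by (simp add: space_PiM)

lemma measurable_gaussd_component:
  assumes "f \<in> measurable M (gaussd d)" "i < d"
  shows "(\<lambda>w. f w i) \<in> borel_measurable M"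
proof -
  have f: "f \<in> measurable M (Pi\<^sub>M {..<d} (\<lambda>_. borel))"
    using assms(1) by (simp cong: measurable_cong_sets add: sets_gaussd)
  show ?thesis
    by (rule measurable_compose[OF f measurable_component_singleton]) (use assms in auto)
qed

lemma measurable_into_gaussd:
  assumes "\<And>i. i < d \<Longrightarrow> (\<lambda>w. f w i) \<in> borel_measurable M"
    and "\<And>w. w \<in> space M \<Longrightarrow> f w \<in> extensional {..<d}"
  shows "f \<in> measurable M (gaussd d)"
proof -
  have "f \<in> measurable M (Pi\<^sub>M {..<d} (\<lambda>_. borel))"
    using assms by (intro measurable_PiM_single') (auto simp: PiE_def)
  then show ?thesis
    by (simp cong: measurable_cong_sets add: sets_gaussd)
qed

lemma measurable_dotd [measurable (raw)]:
  assumes "f \<in> measurable M (gaussd d)" "g \<in> measurable M (gaussd d)"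
  shows "(\<lambda>w. dotd d (f w) (g w)) \<in> borel_measurable M"
  unfolding dotd_def
  by (intro borel_measurable_sum borel_measurable_times
      measurable_gaussd_component[OF assms(1)] measurable_gaussd_component[OF assms(2)]) auto

lemma measurable_dotd_const [measurable (raw)]:
  assumes "g \<in> measurable M (gaussd d)"
  shows "(\<lambda>w. dotd d a (g w)) \<in> borel_measurable M"
  unfolding dotd_def
  by (intro borel_measurable_sum borel_measurable_times borel_measurable_const
      measurable_gaussd_component[OF assms]) auto

lemma measurable_qform [measurable (raw)]:
  assumes "g \<in> measurable M (gaussd d)"
  shows "(\<lambda>w. qform d A (g w) (g w)) \<in> borel_measurable M"
  unfolding qform_def
  by (intro borel_measurable_sum borel_measurable_times borel_measurable_const
      measurable_gaussd_component[OF assms]) auto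

lemma measurable_qform_const [measurable (raw)]:
  assumes "g \<in> measurable M (gaussd d)"
  shows "(\<lambda>w. qform d A x (g w)) \<in> borel_measurable M"
  unfolding qform_def
  by (intro borel_measurable_sum borel_measurable_times borel_measurable_const
      measurable_gaussd_component[OF assms]) auto

lemma measurable_gcrn_z [measurable (raw)]:
  assumes [measurable]: "f \<in> measurable M (gaussd d)" "g \<in> borel_measurable M"
  shows "(\<lambda>w. gcrn_z d n (f w) (g w)) \<in> measurable M (gaussd d)"
proof (rule measurable_into_gaussd)
  fix i assume "i < d"
  note [measurable] = measurable_gaussd_component[OF assms(1) this]
  show "(\<lambda>w. gcrn_z d n (f w) (g w) i) \<in> borel_measurable M"
    using \<open>i < d\<close> by (simp add: gcrn_z_def)
qed (auto simp: gcrn_z_def extensional_def)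

section \<open>Invariance of the Gaussian measure under reflections\<close>

definition gaussd_density :: "nat \<Rightarrow> (nat \<Rightarrow> real) \<Rightarrow> ennreal" where
  "gaussd_density d z = (\<Prod>i<d. ennreal (std_normal_density (z i)))"

text \<open>The dimension is a term and not a type, so Lebesgue measure on \<open>R^d\<close> is
  taken as a product measure on functions, with the same measurable sets as
  \<open>gaussd d\<close>.\<close>

definition lborel_vec :: "nat \<Rightarrow> (nat \<Rightarrow> real) measure" where
  "lborel_vec d = Pi\<^sub>M {..<d} (\<lambda>_. lborel)"

lemma sets_lborel_vec [measurable_cong]: "sets (lborel_vec d) = sets (gaussd d)"
  unfolding gaussd_def lborel_vec_def by (rule sets_PiM_cong) auto

lemma space_lborel_vec: "space (lborel_vec d) = space (gaussd d)"
  by (rule sets_eq_imp_space_eq[OF sets_lborel_vec])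

lemma measurable_gaussd_density [measurable]: "gaussd_density d \<in> borel_measurable (gaussd d)"
  unfolding gaussd_density_def[abs_def]
proof (rule borel_measurable_prod_ennreal)
  fix i assume "i \<in> {..<d}"
  then have [measurable]: "(\<lambda>z. z i) \<in> borel_measurable (gaussd d)"
    by (intro measurable_gaussd_component[OF measurable_ident_sets]) auto
  show "(\<lambda>z. ennreal (std_normal_density (z i))) \<in> borel_measurable (gaussd d)"
    by measurable
qed

interpretation lb: product_sigma_finite "\<lambda>_::nat. lborel :: real measure"
  by standard

lemma sigma_finite_lborel_vec: "sigma_finite_measure (lborel_vec d)"
  unfolding lborel_vec_def by (rule lb.sigma_finite) simp

text \<open>Boxes determine the product measure, and over a box the density integral factorizes. The
  density form lets invariance of the Gaussian be derived from invariance of Lebesgue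
  measure.\<close>

lemma gaussd_eq_density: "gaussd d = density (lborel_vec d) (gaussd_density d)"
proof -
  interpret sn: product_sigma_finite "\<lambda>_::nat. std_normal"
    by (simp add: product_sigma_finite_def prob_space_imp_sigma_finite)
  have "density (lborel_vec d) (gaussd_density d) = Pi\<^sub>M {..<d} (\<lambda>_. std_normal)"
  proof (rule sn.PiM_eqI)
    show "finite {..<d}" by simp
    show "sets (density (lborel_vec d) (gaussd_density d)) = sets (Pi\<^sub>M {..<d} (\<lambda>_. std_normal))"
      by (simp add: sets_lborel_vec) (simp add: gaussd_def)
    fix A :: "nat \<Rightarrow> real set" assume A: "\<And>i. i \<in> {..<d} \<Longrightarrow> A i \<in> sets std_normal"
    have box: "Pi\<^sub>E {..<d} A \<in> sets (lborel_vec d)"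
      unfolding lborel_vec_def using A by (intro sets_PiM_I_finite) auto
    have "emeasure (density (lborel_vec d) (gaussd_density d)) (Pi\<^sub>E {..<d} A)
        = (\<integral>\<^sup>+ z. gaussd_density d z * indicator (Pi\<^sub>E {..<d} A) z \<partial>lborel_vec d)"
      by (rule emeasure_density[OF _ box]) measurable
    also have "\<dots> = (\<integral>\<^sup>+ z. (\<Prod>i<d. ennreal (std_normal_density (z i)) * indicator (A i) (z i)) \<partial>lborel_vec d)"
    proof (rule nn_integral_cong)
      fix z assume z: "z \<in> space (lborel_vec d)"
      have "indicator (Pi\<^sub>E {..<d} A) z = (\<Prod>i<d. indicator (A i) (z i) :: ennreal)"
      proof (cases "z \<in> Pi\<^sub>E {..<d} A")
        case False
        \<comment> \<open>Points of the space are already extensional, so a point outside the box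
          violates it in some coordinate.\<close>
        then obtain i where "i < d" "z i \<notin> A i"
          using z by (auto simp: space_lborel_vec space_gaussd PiE_def)
        then have "(\<Prod>i<d. indicator (A i) (z i) :: ennreal) = 0"
          by (intro prod_zero) (auto intro!: bexI[of _ i])
        with False show ?thesis by simp
      next
        case True
        then have "(\<Prod>i<d. indicator (A i) (z i) :: ennreal) = (\<Prod>i<d. 1)"
          by (intro prod.cong) (auto simp: PiE_mem)
        with True show ?thesis by simp
      qed
      then show "gaussd_density d z * indicator (Pi\<^sub>E {..<d} A) z
          = (\<Prod>i<d. ennreal (std_normal_density (z i)) * indicator (A i) (z i))"
        by (simp add: gaussd_density_def prod.distrib)
    qed
    also have "\<dots> = (\<Prod>i<d. \<integral>\<^sup>+ x. ennreal (std_normal_density x) * indicator (A i) x \<partial>lborel)"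
      unfolding lborel_vec_def using A
      by (intro lb.product_nn_integral_prod) auto
    also have "\<dots> = (\<Prod>i<d. emeasure std_normal (A i))"
      using A by (intro prod.cong) (auto simp: std_normal_def emeasure_density)
    finally show "emeasure (density (lborel_vec d) (gaussd_density d)) (Pi\<^sub>E {..<d} A)
        = (\<Prod>i<d. emeasure std_normal (A i))" .
  qed
  then show ?thesis by (simp add: gaussd_def)
qed

text \<open>The preimage of a box is the box of translated sides, which reduces the claim to
  translation invariance on the line.\<close>

lemma distr_lborel_vec_translate:
  "distr (lborel_vec d) (lborel_vec d) (\<lambda>z. \<lambda>i\<in>{..<d}. z i + a i) = lborel_vec d"
proof -
  have meas: "(\<lambda>z. \<lambda>i\<in>{..<d}. z i + a i) \<in> measurable (lborel_vec d) (lborel_vec d)"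
    unfolding lborel_vec_def by measurable
  have "distr (lborel_vec d) (lborel_vec d) (\<lambda>z. \<lambda>i\<in>{..<d}. z i + a i) = Pi\<^sub>M {..<d} (\<lambda>_. lborel)"
  proof (rule lb.PiM_eqI)
    show "sets (distr (lborel_vec d) (lborel_vec d) (\<lambda>z. \<lambda>i\<in>{..<d}. z i + a i))
        = sets (Pi\<^sub>M {..<d} (\<lambda>_. lborel))"
      by (simp add: lborel_vec_def)
    fix A :: "nat \<Rightarrow> real set" assume A: "\<And>i. i \<in> {..<d} \<Longrightarrow> A i \<in> sets lborel"
    have box: "Pi\<^sub>E {..<d} A \<in> sets (lborel_vec d)"
      unfolding lborel_vec_def using A by (intro sets_PiM_I_finite) auto
    have B: "(\<lambda>x. x + a i) -` A i \<in> sets lborel" if "i < d" for i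
    proof -
      have "(\<lambda>x. x + a i) -` A i \<inter> space borel \<in> sets borel"
        using A that by (intro measurable_sets[where A = borel]) auto
      then show ?thesis by simp
    qed
    have "emeasure (distr (lborel_vec d) (lborel_vec d) (\<lambda>z. \<lambda>i\<in>{..<d}. z i + a i)) (Pi\<^sub>E {..<d} A)
       = emeasure (lborel_vec d) ((\<lambda>z. \<lambda>i\<in>{..<d}. z i + a i) -` Pi\<^sub>E {..<d} A \<inter> space (lborel_vec d))"
      by (rule emeasure_distr[OF meas box])
    also have "(\<lambda>z. \<lambda>i\<in>{..<d}. z i + a i) -` Pi\<^sub>E {..<d} A \<inter> space (lborel_vec d)
       = Pi\<^sub>E {..<d} (\<lambda>i. (\<lambda>x. x + a i) -` A i)"
      by (auto simp: space_lborel_vec space_gaussd PiE_def Pi_def)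
    also have "emeasure (lborel_vec d) \<dots> = (\<Prod>i<d. emeasure lborel ((\<lambda>x. x + a i) -` A i))"
      unfolding lborel_vec_def using B by (intro lb.emeasure_PiM) auto
    also have "\<dots> = (\<Prod>i<d. emeasure lborel (A i))"
    proof (rule prod.cong)
      fix i assume i: "i \<in> {..<d}"
      have plus: "(+) (a i) = (\<lambda>x. x + a i)" by auto
      have "emeasure lborel (A i) = emeasure (distr lborel borel ((+) (a i))) (A i)"
        by (simp add: lborel_distr_plus)
      also have "\<dots> = emeasure lborel ((\<lambda>x. x + a i) -` A i)"
        using A[OF i] plus by (simp add: emeasure_distr)
      finally show "emeasure lborel ((\<lambda>x. x + a i) -` A i) = emeasure lborel (A i)" ..
    qed simp
    finally show "emeasure (distr (lborel_vec d) (lborel_vec d) (\<lambda>z. \<lambda>i\<in>{..<d}. z i + a i)) (Pi\<^sub>E {..<d} A)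
       = (\<Prod>i<d. emeasure lborel (A i))" .
  qed simp
  then show ?thesis by (simp add: lborel_vec_def)
qed

lemma gaussd_density_eq:
  "gaussd_density d z = ennreal ((1 / sqrt (2 * pi)) ^ d * exp (- dotd d z z / 2))"
proof -
  have "gaussd_density d z = ennreal (\<Prod>i<d. std_normal_density (z i))"
    unfolding gaussd_density_def by (subst prod_ennreal) (auto simp: normal_density_nonneg)
  also have "(\<Prod>i<d. std_normal_density (z i)) = (1 / sqrt (2 * pi)) ^ d * (\<Prod>i<d. exp (- (z i)\<^sup>2 / 2))"
    by (simp add: std_normal_density_def prod.distrib prod_dividef power_divide)
  also have "(\<Prod>i<d. exp (- (z i)\<^sup>2 / 2)) = exp (- dotd d z z / 2)"
    by (simp add: exp_sum[symmetric] dotd_def sum_negf[symmetric] sum_divide_distrib power2_eq_square)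
  finally show ?thesis .
qed

lemma dotd_add_scaled:
  "dotd d n (\<lambda>i\<in>{..<d}. z i + w * n i) = dotd d n z + w * dotd d n n"
  by (simp add: dotd_def algebra_simps sum.distrib sum_distrib_left)

lemma dotd_add_scaled_self:
  "dotd d (\<lambda>i\<in>{..<d}. z i + w * n i) (\<lambda>i\<in>{..<d}. z i + w * n i)
     = dotd d z z + 2 * w * dotd d n z + w\<^sup>2 * dotd d n n"
  by (simp add: dotd_def algebra_simps sum.distrib sum_distrib_left power2_eq_square)

text \<open>A GCRN proposal is \<open>z\<close> displaced along \<open>n\<close> by the scalar
  \<open>z1 - dotd d n z\<close>. This scalar is the substitution variable of the reflection
  argument and controls the distance between the two proposals.\<close>

lemma gcrn_z_eq: "gcrn_z d n z z1 = (\<lambda>i\<in>{..<d}. z i + (z1 - dotd d n z) * n i)"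
  by (auto simp: gcrn_z_def algebra_simps)

text \<open>The real variable is integrated innermost, so that an affine substitution depending on
  \<open>z\<close> can be made in it.\<close>

lemma nn_integral_gauss_pair:
  assumes [measurable]: "F \<in> borel_measurable (std_normal \<Otimes>\<^sub>M gaussd d)"
  shows "(\<integral>\<^sup>+w. F w \<partial>(std_normal \<Otimes>\<^sub>M gaussd d))
     = (\<integral>\<^sup>+z. \<integral>\<^sup>+z1. ennreal (std_normal_density z1) * gaussd_density d z * F (z1, z) \<partial>lborel \<partial>lborel_vec d)"
proof -
  interpret P: pair_sigma_finite std_normal "gaussd d"
    by (simp add: pair_sigma_finite_def prob_space_imp_sigma_finite)
  have "(\<integral>\<^sup>+w. F w \<partial>(std_normal \<Otimes>\<^sub>M gaussd d)) = (\<integral>\<^sup>+z. \<integral>\<^sup>+z1. F (z1, z) \<partial>std_normal \<partial>gaussd d)"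
    by (subst P.nn_integral_snd[symmetric]) auto
  also have "\<dots> = (\<integral>\<^sup>+z. gaussd_density d z * (\<integral>\<^sup>+z1. F (z1, z) \<partial>std_normal) \<partial>lborel_vec d)"
    unfolding gaussd_eq_density[of d]
  proof (rule nn_integral_density)
    show "gaussd_density d \<in> borel_measurable (lborel_vec d)" by measurable
    show "(\<lambda>z. \<integral>\<^sup>+z1. F (z1, z) \<partial>std_normal) \<in> borel_measurable (lborel_vec d)"
      by (intro P.M1.borel_measurable_nn_integral) measurable
  qed
  also have "\<dots> = (\<integral>\<^sup>+z. \<integral>\<^sup>+z1. ennreal (std_normal_density z1) * gaussd_density d z * F (z1, z) \<partial>lborel \<partial>lborel_vec d)"
  proof (rule nn_integral_cong)
    fix z assume z: "z \<in> space (lborel_vec d)"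
    then have [measurable]: "z \<in> space (gaussd d)" by (simp add: space_lborel_vec)
    have [measurable]: "(\<lambda>z1. F (z1, z)) \<in> borel_measurable borel"
      using measurable_Pair1[OF assms, of z] z by simp
    have "(\<integral>\<^sup>+z1. F (z1, z) \<partial>std_normal) = (\<integral>\<^sup>+z1. ennreal (std_normal_density z1) * F (z1, z) \<partial>lborel)"
      unfolding std_normal_def by (rule nn_integral_density) auto
    then show "gaussd_density d z * (\<integral>\<^sup>+z1. F (z1, z) \<partial>std_normal)
        = (\<integral>\<^sup>+z1. ennreal (std_normal_density z1) * gaussd_density d z * F (z1, z) \<partial>lborel)"
      by (simp add: nn_integral_cmult[symmetric] mult_ac)
  qed
  finally show ?thesis .
qed

lemma nn_integral_lborel_vec_translate:
  assumes [measurable]: "F \<in> borel_measurable (gaussd d)"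
  shows "(\<integral>\<^sup>+z. F (\<lambda>i\<in>{..<d}. z i + a i) \<partial>lborel_vec d) = (\<integral>\<^sup>+z. F z \<partial>lborel_vec d)"
proof -
  have meas: "(\<lambda>z. \<lambda>i\<in>{..<d}. z i + a i) \<in> measurable (lborel_vec d) (lborel_vec d)"
    unfolding lborel_vec_def by measurable
  have "(\<integral>\<^sup>+z. F z \<partial>distr (lborel_vec d) (lborel_vec d) (\<lambda>z. \<lambda>i\<in>{..<d}. z i + a i))
      = (\<integral>\<^sup>+z. F (\<lambda>i\<in>{..<d}. z i + a i) \<partial>lborel_vec d)"
    by (rule nn_integral_distr[OF meas]) simp
  then show ?thesis by (simp add: distr_lborel_vec_translate)
qed

text \<open>The map from \<open>(z1, z)\<close> to \<open>(dotd d n z, gcrn_z d n z z1)\<close>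
  preserves the Euclidean norm of \<open>R^(1+d)\<close>, and the joint density depends on that norm
  alone.\<close>

lemma gaussd_densities_reflect:
  assumes "dotd d n n = 1"
  shows "ennreal (std_normal_density (dotd d n z)) * gaussd_density d (gcrn_z d n z z1)
       = ennreal (std_normal_density z1) * gaussd_density d z"
proof -
  have "(dotd d n z)\<^sup>2 + dotd d (gcrn_z d n z z1) (gcrn_z d n z z1) = z1\<^sup>2 + dotd d z z"
    unfolding gcrn_z_eq dotd_add_scaled_self assms by (simp add: power2_eq_square algebra_simps)
  then have "exp (- (dotd d n z)\<^sup>2 / 2) * exp (- dotd d (gcrn_z d n z z1) (gcrn_z d n z z1) / 2)
      = exp (- z1\<^sup>2 / 2) * exp (- dotd d z z / 2)"
    by (simp add: exp_add[symmetric] field_simps)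
  then show ?thesis
    by (simp add: gaussd_density_eq std_normal_density_def ennreal_mult[symmetric] mult_ac)
qed

text \<open>The map below is the reflection exchanging the first coordinate axis with \<open>(0, n)\<close>. Substituting
  \<open>w = z1 - n \<bullet> z\<close> factors it into shears, so that Fubini and translation invariance suffice.\<close>

lemma gauss_reflection:
  assumes n: "dotd d n n = 1"
  shows "distr (std_normal \<Otimes>\<^sub>M gaussd d) (std_normal \<Otimes>\<^sub>M gaussd d)
           (\<lambda>(z1, z). (dotd d n z, gcrn_z d n z z1)) = std_normal \<Otimes>\<^sub>M gaussd d"
    (is "distr ?M ?M ?R = ?M")
proof (rule measure_eqI)
  interpret V: sigma_finite_measure "lborel_vec d" by (rule sigma_finite_lborel_vec)
  interpret P: pair_sigma_finite "lborel :: real measure" "lborel_vec d" ..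
  have R [measurable]: "?R \<in> measurable ?M ?M" by measurable
  fix A assume "A \<in> sets (distr ?M ?M ?R)"
  then have A [measurable]: "A \<in> sets ?M" by simp
  define F where "F = (indicator A :: _ \<Rightarrow> ennreal)"
  have F [measurable]: "F \<in> borel_measurable ?M" unfolding F_def by measurable
  define H where "H a b = ennreal (std_normal_density a) * gaussd_density d b * F (a, b)" for a b
  have H [measurable (raw)]: "(\<lambda>w. H (f w) (g w)) \<in> borel_measurable N"
    if [measurable]: "f \<in> borel_measurable N" "g \<in> measurable N (gaussd d)" for f g and N :: "'b measure"
    unfolding H_def by measurable
  have shift [measurable (raw)]: "(\<lambda>w. \<lambda>i\<in>{..<d}. g w i + f w * n i) \<in> measurable N (gaussd d)"
    if fg [measurable]: "f \<in> borel_measurable N" "g \<in> measurable N (gaussd d)" for f g and N :: "'b measure"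
  proof (rule measurable_into_gaussd)
    fix i assume "i < d"
    note [measurable] = measurable_gaussd_component[OF fg(2) this]
    show "(\<lambda>w. (\<lambda>i\<in>{..<d}. g w i + f w * n i) i) \<in> borel_measurable N"
      using \<open>i < d\<close> by simp
  qed auto
  have "emeasure (distr ?M ?M ?R) A = (\<integral>\<^sup>+w. F w \<partial>distr ?M ?M ?R)"
    unfolding F_def by (rule nn_integral_indicator[symmetric]) (simp only: sets_distr A)
  also have "\<dots> = (\<integral>\<^sup>+w. F (?R w) \<partial>?M)"
    by (rule nn_integral_distr[OF R]) simp
  \<comment> \<open>The density at \<open>(z1, z)\<close> is replaced by its equal value at the
    image point, so that the integrand becomes \<open>H\<close> composed with the
    reflection.\<close>
  also have "\<dots> = (\<integral>\<^sup>+z. \<integral>\<^sup>+z1. H (dotd d n z) (gcrn_z d n z z1) \<partial>lborel \<partial>lborel_vec d)"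
    by (subst nn_integral_gauss_pair) (simp_all add: H_def gaussd_densities_reflect[OF n])
  also have "\<dots> = (\<integral>\<^sup>+z. \<integral>\<^sup>+w. H (dotd d n z) (\<lambda>i\<in>{..<d}. z i + w * n i) \<partial>lborel \<partial>lborel_vec d)"
  proof (rule nn_integral_cong)
    fix z assume "z \<in> space (lborel_vec d)"
    then have [measurable]: "z \<in> space (gaussd d)" by (simp add: space_lborel_vec)
    show "(\<integral>\<^sup>+z1. H (dotd d n z) (gcrn_z d n z z1) \<partial>lborel)
       = (\<integral>\<^sup>+w. H (dotd d n z) (\<lambda>i\<in>{..<d}. z i + w * n i) \<partial>lborel)"
      by (subst nn_integral_real_affine[where c = 1 and t = "dotd d n z"]) (simp_all add: gcrn_z_eq)
  qed
  also have "\<dots> = (\<integral>\<^sup>+w. \<integral>\<^sup>+z. H (dotd d n z) (\<lambda>i\<in>{..<d}. z i + w * n i) \<partial>lborel_vec d \<partial>lborel)"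
    by (rule P.Fubini') measurable
  \<comment> \<open>A shift of \<open>z\<close> by \<open>w * n\<close> raises
    \<open>dotd d n z\<close> by exactly \<open>w\<close>, since \<open>n\<close> is a unit vector;
    subtracting \<open>w\<close> in the first argument compensates for it.\<close>
  also have "\<dots> = (\<integral>\<^sup>+w. \<integral>\<^sup>+z. H (dotd d n z - w) z \<partial>lborel_vec d \<partial>lborel)"
  proof (rule nn_integral_cong)
    fix w :: real
    show "(\<integral>\<^sup>+z. H (dotd d n z) (\<lambda>i\<in>{..<d}. z i + w * n i) \<partial>lborel_vec d)
        = (\<integral>\<^sup>+z. H (dotd d n z - w) z \<partial>lborel_vec d)"
      by (subst nn_integral_lborel_vec_translate[where a = "\<lambda>i. w * n i", symmetric])
         (simp_all add: dotd_add_scaled n)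
  qed
  also have "\<dots> = (\<integral>\<^sup>+z. \<integral>\<^sup>+w. H (dotd d n z - w) z \<partial>lborel \<partial>lborel_vec d)"
    by (rule P.Fubini'[symmetric]) measurable
  also have "\<dots> = (\<integral>\<^sup>+z. \<integral>\<^sup>+z1. H z1 z \<partial>lborel \<partial>lborel_vec d)"
  proof (rule nn_integral_cong)
    fix z assume "z \<in> space (lborel_vec d)"
    then have [measurable]: "z \<in> space (gaussd d)" by (simp add: space_lborel_vec)
    show "(\<integral>\<^sup>+w. H (dotd d n z - w) z \<partial>lborel) = (\<integral>\<^sup>+z1. H z1 z \<partial>lborel)"
      by (subst (2) nn_integral_real_affine[where c = "-1" and t = "dotd d n z"]) simp_all
  qed
  also have "\<dots> = (\<integral>\<^sup>+w. F w \<partial>?M)"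
    by (subst nn_integral_gauss_pair) (simp_all add: H_def)
  also have "\<dots> = emeasure ?M A"
    unfolding F_def by (rule nn_integral_indicator[OF A])
  finally show "emeasure (distr ?M ?M ?R) A = emeasure ?M A" .
qed simp

lemma dotd_gcrn_z: "dotd d n n = 1 \<Longrightarrow> dotd d n (gcrn_z d n z z1) = z1"
  by (simp add: gcrn_z_eq dotd_add_scaled)

lemma distr_gauss_fst: "distr (std_normal \<Otimes>\<^sub>M gaussd d) std_normal fst = std_normal"
proof -
  interpret prob_space "gaussd d" by simp
  show ?thesis by (rule distr_pair_fst)
qed

lemma distr_pair_snd:
  assumes "prob_space A" "sigma_finite_measure B"
  shows "distr (A \<Otimes>\<^sub>M B) B snd = B"
proof -
  interpret A: prob_space A by fact
  interpret B: sigma_finite_measure B by fact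
  interpret pair_sigma_finite A B ..
  have "distr (A \<Otimes>\<^sub>M B) B snd = distr (distr (B \<Otimes>\<^sub>M A) (A \<Otimes>\<^sub>M B) (\<lambda>(x, y). (y, x))) B snd"
    by (subst distr_pair_swap) simp
  also have "\<dots> = distr (B \<Otimes>\<^sub>M A) B fst"
    by (subst distr_distr) (auto simp: comp_def case_prod_beta)
  also have "\<dots> = B" by (rule A.distr_pair_fst)
  finally show ?thesis .
qed

lemma distr_gauss_snd: "distr (std_normal \<Otimes>\<^sub>M gaussd d) (gaussd d) snd = gaussd d"
  by (intro distr_pair_snd prob_space_imp_sigma_finite) auto

text \<open>For a unit vector the proposal is the second component of the reflection. For the zero
  vector it is \<open>z\<close> itself.\<close>

lemma distr_gcrn_z:
  assumes "dotd d n n = 1 \<or> (\<forall>i<d. n i = 0)"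
  shows "distr (std_normal \<Otimes>\<^sub>M gaussd d) (gaussd d) (\<lambda>(z1, z). gcrn_z d n z z1) = gaussd d"
  using assms
proof
  assume n: "dotd d n n = 1"
  have "distr (std_normal \<Otimes>\<^sub>M gaussd d) (gaussd d) (\<lambda>(z1, z). gcrn_z d n z z1)
      = distr (distr (std_normal \<Otimes>\<^sub>M gaussd d) (std_normal \<Otimes>\<^sub>M gaussd d)
           (\<lambda>(z1, z). (dotd d n z, gcrn_z d n z z1))) (gaussd d) snd"
    by (subst distr_distr) (auto simp: comp_def case_prod_beta[abs_def])
  then show ?thesis by (simp add: gauss_reflection[OF n] distr_gauss_snd)
next
  assume n: "\<forall>i<d. n i = 0"
  have "distr (std_normal \<Otimes>\<^sub>M gaussd d) (gaussd d) (\<lambda>(z1, z). gcrn_z d n z z1)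
     = distr (std_normal \<Otimes>\<^sub>M gaussd d) (gaussd d) snd"
    using n by (intro distr_cong)
      (auto simp: gcrn_z_def space_pair_measure space_gaussd fun_eq_iff PiE_def extensional_def)
  then show ?thesis by (simp add: distr_gauss_snd)
qed

text \<open>A Gaussian vector may be replaced by a GCRN proposal of the same law, whose component
  along \<open>n\<close> is exactly \<open>z1\<close>.\<close>

lemma distr_dotd_gauss:
  assumes n: "dotd d n n = 1"
  shows "distr (gaussd d) borel (dotd d n) = std_normal"
proof -
  have "distr (gaussd d) borel (dotd d n)
      = distr (distr (std_normal \<Otimes>\<^sub>M gaussd d) (gaussd d) (\<lambda>(z1, z). gcrn_z d n z z1)) borel (dotd d n)"
    by (simp add: distr_gcrn_z n)
  also have "\<dots> = distr (std_normal \<Otimes>\<^sub>M gaussd d) std_normal fst"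
    by (subst distr_distr) (auto simp: comp_def case_prod_beta dotd_gcrn_z n intro!: distr_cong)
  finally show ?thesis by (simp add: distr_gauss_fst)
qed

section \<open>The GCRN coupling\<close>

lemma sets_unif01 [measurable_cong, simp]: "sets unif01 = sets borel"
  by (simp add: unif01_def)

lemma space_unif01 [simp]: "space unif01 = UNIV"
  by (simp add: unif01_def)

lemma prob_space_unif01 [simp, intro]: "prob_space unif01"
  unfolding unif01_def by (rule prob_space_uniform_measure) auto

lemma unif01_cdf:
  assumes "a \<ge> 0"
  shows "(\<integral>u. (if u \<le> a then 1 else 0) \<partial>unif01) = (min 1 a :: real)"
proof -
  have "(\<lambda>u. if u \<le> a then 1 else 0 :: real) = indicator {..a}"
    by (auto simp: indicator_def)
  then have "(\<integral>u. (if u \<le> a then 1 else 0 :: real) \<partial>unif01) = measure unif01 {..a}"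
    by simp
  also have "\<dots> = measure lborel ({0..1} \<inter> {..a}) / measure lborel {0..1::real}"
    unfolding unif01_def by (rule measure_uniform_measure) auto
  also have "{0..1} \<inter> {..a} = {0..min 1 a}" by auto
  finally show ?thesis using assms by simp
qed

lemma dotd_scale: "dotd d (\<lambda>i. c * u i) (\<lambda>i. c * u i) = c\<^sup>2 * dotd d u u"
  by (simp add: dotd_def sum_distrib_left power2_eq_square mult_ac)

lemma dotd_self_nonneg: "dotd d u u \<ge> 0"
  by (auto simp: dotd_def intro!: sum_nonneg)

lemma dotd_self_eq_0_iff: "dotd d u u = 0 \<longleftrightarrow> (\<forall>i<d. u i = 0)"
  unfolding dotd_def by (subst sum_nonneg_eq_0_iff) auto

lemma nvec_unit: "vnorm d (mvec d Om x) \<noteq> 0 \<Longrightarrow> dotd d (nvec d Om x) (nvec d Om x) = 1"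
  using dotd_scale[of d "- 1 / vnorm d (mvec d Om x)" "mvec d Om x"] dotd_self_nonneg[of d "mvec d Om x"]
  by (simp add: nvec_def vnorm_def power_divide)

text \<open>The second alternative is the state of vanishing gradient, where
  \<open>x / 0 = 0\<close> turns the normalised vector into zero.\<close>

lemma nvec_cases: "dotd d (nvec d Om x) (nvec d Om x) = 1 \<or> (\<forall>i<d. nvec d Om x i = 0)"
  using nvec_unit[of d Om x] by (cases "vnorm d (mvec d Om x) = 0") (auto simp: nvec_def)

lemma measurable_coupling_components [measurable]:
  "(\<lambda>w. fst (fst w)) \<in> borel_measurable (MU \<Otimes>\<^sub>M MZ d)"
  "(\<lambda>w. snd (fst w)) \<in> borel_measurable (MU \<Otimes>\<^sub>M MZ d)"
  "(\<lambda>w. fst (snd w)) \<in> measurable (MU \<Otimes>\<^sub>M MZ d) (gaussd d)"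
  "(\<lambda>w. snd (snd w)) \<in> measurable (MU \<Otimes>\<^sub>M MZ d) (gaussd d)"
  unfolding MU_def MZ_def by measurable

text \<open>The uniforms depend on \<open>u\<close> only and the proposals on \<open>(z1, z)\<close>
  only, so the image of the product measure is again a product; this is the independence required by
  the class.\<close>

lemma gcrn_coupling_eq_pair:
  "gcrn_coupling d Om x y = distr unif01 MU (\<lambda>u. (u, u))
     \<Otimes>\<^sub>M distr (std_normal \<Otimes>\<^sub>M gaussd d) (MZ d)
           (\<lambda>(z1, z). (gcrn_z d (nvec d Om x) z z1, gcrn_z d (nvec d Om y) z z1))"
proof -
  interpret Q: pair_prob_space std_normal "gaussd d"
    by (simp add: pair_prob_space_def pair_sigma_finite_def prob_space_imp_sigma_finite)
  have g: "(\<lambda>(z1, z). (gcrn_z d (nvec d Om x) z z1, gcrn_z d (nvec d Om y) z z1))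
      \<in> measurable (std_normal \<Otimes>\<^sub>M gaussd d) (MZ d)"
    unfolding MZ_def by measurable
  have u: "(\<lambda>u. (u, u)) \<in> measurable unif01 MU" unfolding MU_def by measurable
  have "sigma_finite_measure (distr (std_normal \<Otimes>\<^sub>M gaussd d) (MZ d)
      (\<lambda>(z1, z). (gcrn_z d (nvec d Om x) z z1, gcrn_z d (nvec d Om y) z z1)))"
    by (intro prob_space_imp_sigma_finite Q.prob_space_distr g)
  from pair_measure_distr[OF u g this] show ?thesis
    unfolding gcrn_coupling_def by (simp add: case_prod_beta[abs_def])
qed

lemma
  shows distr_gcrn_coupling_fst:
      "distr (gcrn_coupling d Om x y) MU fst = distr unif01 MU (\<lambda>u. (u, u))" (is "?fst")
    and distr_gcrn_coupling_snd:
      "distr (gcrn_coupling d Om x y) (MZ d) snd = distr (std_normal \<Otimes>\<^sub>M gaussd d) (MZ d)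
         (\<lambda>(z1, z). (gcrn_z d (nvec d Om x) z z1, gcrn_z d (nvec d Om y) z z1))" (is "?snd")
proof -
  let ?Q = "std_normal \<Otimes>\<^sub>M gaussd d"
  let ?g = "\<lambda>(z1, z). (gcrn_z d (nvec d Om x) z z1, gcrn_z d (nvec d Om y) z z1)"
  let ?K = "gcrn_coupling d Om x y"
  interpret Q: pair_prob_space std_normal "gaussd d"
    by (simp add: pair_prob_space_def pair_sigma_finite_def prob_space_imp_sigma_finite)
  have g: "?g \<in> measurable ?Q (MZ d)" unfolding MZ_def by measurable
  have u: "(\<lambda>u. (u, u)) \<in> measurable unif01 MU" unfolding MU_def by measurable
  interpret U: prob_space "distr unif01 MU (\<lambda>u. (u, u))"
    by (rule prob_space.prob_space_distr[OF prob_space_unif01 u])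
  interpret Z: prob_space "distr ?Q (MZ d) ?g"
    by (rule Q.prob_space_distr[OF g])
  have "distr ?K MU fst = distr ?K (distr unif01 MU (\<lambda>u. (u, u))) fst"
    by (rule distr_cong) simp_all
  also have "\<dots> = distr unif01 MU (\<lambda>u. (u, u))"
    unfolding gcrn_coupling_eq_pair by (rule Z.distr_pair_fst)
  finally show ?fst .
  have "distr ?K (MZ d) snd = distr ?K (distr ?Q (MZ d) ?g) snd"
    by (rule distr_cong) simp_all
  also have "\<dots> = distr ?Q (MZ d) ?g"
    unfolding gcrn_coupling_eq_pair
    by (intro distr_pair_snd U.prob_space_axioms prob_space_imp_sigma_finite Z.prob_space_axioms)
  finally show ?snd .
qed

text \<open>Besides placing the GCRN value below the supremum, this shows that the supremum is over
  a nonempty set.\<close>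

lemma gcrn_coupling_in_couplings_I: "gcrn_coupling d Om x y \<in> couplings_I d"
proof -
  let ?Q = "std_normal \<Otimes>\<^sub>M gaussd d"
  let ?P = "unif01 \<Otimes>\<^sub>M ?Q"
  let ?f = "\<lambda>(u :: real, z1, z). ((u, u), (gcrn_z d (nvec d Om x) z z1, gcrn_z d (nvec d Om y) z z1))"
  let ?K = "gcrn_coupling d Om x y"
  interpret Q: pair_prob_space std_normal "gaussd d"
    by (simp add: pair_prob_space_def pair_sigma_finite_def prob_space_imp_sigma_finite)
  interpret P: pair_prob_space unif01 ?Q
    by (simp add: pair_prob_space_def pair_sigma_finite_def prob_space_imp_sigma_finite Q.prob_space_axioms)
  have f: "?f \<in> measurable ?P (MU \<Otimes>\<^sub>M MZ d)"
    unfolding MU_def MZ_def by measurable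
  have K: "?K = distr ?P (MU \<Otimes>\<^sub>M MZ d) ?f" by (simp add: gcrn_coupling_def)
  have fst_P: "distr ?P unif01 fst = unif01" by (rule Q.distr_pair_fst)
  have snd_P: "distr ?P ?Q snd = ?Q"
    by (intro distr_pair_snd prob_space_imp_sigma_finite prob_space_unif01 Q.prob_space_axioms)
  have z: "distr ?P (gaussd d) (\<lambda>w. gcrn_z d n (snd (snd w)) (fst (snd w))) = gaussd d"
    if "dotd d n n = 1 \<or> (\<forall>i<d. n i = 0)" for n
  proof -
    have "distr ?P (gaussd d) (\<lambda>w. gcrn_z d n (snd (snd w)) (fst (snd w)))
        = distr (distr ?P ?Q snd) (gaussd d) (\<lambda>(z1, z). gcrn_z d n z z1)"
      by (subst distr_distr) (auto simp: comp_def case_prod_beta[abs_def])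
    then show ?thesis by (simp only: snd_P distr_gcrn_z[OF that])
  qed
  have "distr ?P borel fst = distr ?P unif01 fst" by (rule distr_cong) simp_all
  with fst_P have uu: "distr ?P borel fst = unif01" by simp
  have "?K = distr ?K MU fst \<Otimes>\<^sub>M distr ?K (MZ d) snd"
    by (simp only: distr_gcrn_coupling_fst distr_gcrn_coupling_snd) (rule gcrn_coupling_eq_pair)
  moreover have "distr ?K borel (\<lambda>w. fst (fst w)) = unif01" "distr ?K borel (\<lambda>w. snd (fst w)) = unif01"
    unfolding K using uu
    by (subst distr_distr[OF _ f]; simp add: comp_def case_prod_beta[abs_def])+
  moreover have "distr ?K (gaussd d) (\<lambda>w. fst (snd w)) = gaussd d"
     "distr ?K (gaussd d) (\<lambda>w. snd (snd w)) = gaussd d"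
    unfolding K using z[OF nvec_cases[of d Om x]] z[OF nvec_cases[of d Om y]]
    by (subst distr_distr[OF _ f]; simp add: comp_def case_prod_beta[abs_def])+
  moreover have "prob_space ?K" unfolding K by (rule P.prob_space_distr[OF f])
  moreover have "sets ?K = sets (MU \<Otimes>\<^sub>M MZ d)" by (simp add: K)
  ultimately show ?thesis by (simp add: couplings_I_def)
qed

section \<open>Gaussian moments\<close>

lemma integrable_std_normal_power [simp]: "integrable std_normal (\<lambda>x. x ^ k)"
  unfolding std_normal_def
  by (subst integrable_density) (simp_all add: integrable_std_normal_moment)

lemma std_normal_second_moment: "(\<integral>x. x\<^sup>2 \<partial>std_normal) = 1"
  unfolding std_normal_def
  using integral_std_normal_moment_even[of 1] by (subst integral_density) (auto simp: fact_numeral)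

lemma distr_gaussd_component:
  assumes "i < d"
  shows "distr (gaussd d) borel (\<lambda>z. z i) = std_normal"
proof -
  have "distr (gaussd d) borel (\<lambda>z. z i) = distr (gaussd d) std_normal (\<lambda>z. z i)"
    by (rule distr_cong) simp_all
  also have "\<dots> = std_normal"
    unfolding gaussd_def using assms by (intro distr_PiM_component) auto
  finally show ?thesis .
qed

lemma integrable_gaussd_component_power:
  assumes "i < d"
  shows "integrable (gaussd d) (\<lambda>z. z i ^ k)"
proof -
  have m: "(\<lambda>z. z i) \<in> borel_measurable (gaussd d)"
    using assms by (intro measurable_gaussd_component[OF measurable_ident_sets]) auto
  have "integrable (distr (gaussd d) borel (\<lambda>z. z i)) (\<lambda>x. x ^ k)"
    by (simp add: distr_gaussd_component[OF assms])
  then show ?thesis by (subst (asm) integrable_distr_eq[OF m]) auto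
qed

text \<open>By Cauchy-Schwarz the squared sum is at most \<open>card I\<close> times the sum of
  squares; for infinite \<open>I\<close> the sum is 0 by convention.\<close>

lemma square_integrable_sum:
  fixes f :: "'i \<Rightarrow> 'a \<Rightarrow> real"
  assumes "\<And>i. i \<in> I \<Longrightarrow> f i \<in> borel_measurable M" "\<And>i. i \<in> I \<Longrightarrow> integrable M (\<lambda>x. (f i x)\<^sup>2)"
  shows "integrable M (\<lambda>x. (\<Sum>i\<in>I. f i x)\<^sup>2)"
proof (cases "finite I")
  case True
  show ?thesis
  proof (rule Bochner_Integration.integrable_bound)
    show "integrable M (\<lambda>x. real (card I) * (\<Sum>i\<in>I. (f i x)\<^sup>2))"
      using assms(2) by auto
    show "AE x in M. norm ((\<Sum>i\<in>I. f i x)\<^sup>2) \<le> norm (real (card I) * (\<Sum>i\<in>I. (f i x)\<^sup>2))"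
      using sum_squared_le_sum_of_squares[of _ I] True
      by (auto simp: sum_nonneg mult.commute)
  qed (use assms(1) in measurable)
qed auto

text \<open>A Bochner integral of a non-integrable function is 0 by default. Integrability is what
  turns the integrals of the limit assumption into genuine second moments. Each squared entry is
  dominated by fourth powers of coordinates.\<close>

lemma integrable_qform_squared: "integrable (gaussd d) (\<lambda>z. (qform d A z z)\<^sup>2)"
proof -
  have m [measurable]: "(\<lambda>z. z i) \<in> borel_measurable (gaussd d)" if "i < d" for i
    using that by (intro measurable_gaussd_component[OF measurable_ident_sets]) auto
  have "integrable (gaussd d) (\<lambda>z. (z i * A i j * z j)\<^sup>2)" if ij: "i < d" "j < d" for i j
  proof (rule Bochner_Integration.integrable_bound)
    show "integrable (gaussd d) (\<lambda>z. (A i j)\<^sup>2 * (z i ^ 4 + z j ^ 4))"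
      using ij by (intro integrable_mult_right Bochner_Integration.integrable_add
          integrable_gaussd_component_power)
    show "(\<lambda>z. (z i * A i j * z j)\<^sup>2) \<in> borel_measurable (gaussd d)"
      using m[OF ij(1)] m[OF ij(2)] by measurable
    have "(a * c * b)\<^sup>2 \<le> c\<^sup>2 * (a ^ 4 + b ^ 4)" for a b c :: real
    proof -
      have "a\<^sup>2 * b\<^sup>2 \<le> (a\<^sup>2)\<^sup>2 + (b\<^sup>2)\<^sup>2"
        using sum_squares_bound[of "a\<^sup>2" "b\<^sup>2"]
          mult_nonneg_nonneg[OF zero_le_power2[of a] zero_le_power2[of b]] by linarith
      then have "c\<^sup>2 * (a\<^sup>2 * b\<^sup>2) \<le> c\<^sup>2 * (a ^ 4 + b ^ 4)"
        by (intro mult_left_mono) (auto simp: power_mult[symmetric])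
      then show ?thesis by (simp add: power_mult_distrib mult_ac)
    qed
    then show "AE z in gaussd d. norm ((z i * A i j * z j)\<^sup>2) \<le> norm ((A i j)\<^sup>2 * (z i ^ 4 + z j ^ 4))"
      by simp
  qed
  then show ?thesis
    unfolding qform_def by (intro square_integrable_sum borel_measurable_sum)
      (auto intro!: borel_measurable_times m)
qed

text \<open>This is nonnegativity of the variance of the absolute value.\<close>

lemma (in prob_space) expectation_abs_le_sqrt:
  fixes X :: "'a \<Rightarrow> real"
  assumes X: "X \<in> borel_measurable M" "integrable M (\<lambda>x. (X x)\<^sup>2)"
  shows "expectation (\<lambda>x. \<bar>X x\<bar>) \<le> sqrt (expectation (\<lambda>x. (X x)\<^sup>2))"
proof (rule real_le_rsqrt)
  have i: "integrable M (\<lambda>x. \<bar>X x\<bar>)" using square_integrable_imp_integrable[OF X] by simp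
  have "0 \<le> variance (\<lambda>x. \<bar>X x\<bar>)" by (rule variance_positive)
  also have "\<dots> = expectation (\<lambda>x. (X x)\<^sup>2) - (expectation (\<lambda>x. \<bar>X x\<bar>))\<^sup>2"
    using variance_eq[OF i] X by simp
  finally show "(expectation (\<lambda>x. \<bar>X x\<bar>))\<^sup>2 \<le> expectation (\<lambda>x. (X x)\<^sup>2)" by simp
qed

text \<open>The exponential has slope at most 1 on the negative half-line, and the truncation is
  constant on the positive one. Hence an error in the exponent costs at most itself in the
  acceptance probability.\<close>

lemma min_exp_lipschitz: "\<bar>min 1 (exp a) - min 1 (exp b)\<bar> \<le> \<bar>a - b\<bar>" for a b :: real
proof -
  have "min 1 (exp b) - min 1 (exp a) \<le> b - a" if "a \<le> b" for a b :: real
  proof -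
    have 1: "1 - exp (a - c) \<le> c - a" for c using exp_ge_add_one_self[of "a - c"] by linarith
    consider "0 \<le> a" | "a < 0" "0 \<le> b" | "b < 0" by linarith
    then show ?thesis
    proof cases
      case 3
      have "exp b - exp a = exp b * (1 - exp (a - b))" by (simp add: algebra_simps exp_add[symmetric])
      also have "\<dots> \<le> 1 * (b - a)"
        using 3 that 1[of b] by (intro mult_mono) auto
      finally show ?thesis using 3 that by simp
    qed (use that 1[of 0] in auto)
  qed
  from this[of a b] this[of b a] show ?thesis
    by (cases "a \<le> b") (auto simp: abs_if min_def split: if_splits)
qed

section \<open>Quadratic and linear forms\<close>

text \<open>The product \<open>B^T A B\<close> is evaluated in two ways: as
  \<open>(A B)^T B = B\<close>, using the symmetry of \<open>A\<close>, and as
  \<open>B^T (A B) = B^T\<close>.\<close>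

lemma inverse_mat_symmetric:
  assumes A: "sym_pos_def_mat d A" and B: "inverse_mat d A B" and ij: "i < d" "j < d"
  shows "B i j = B j i"
proof -
  have sym: "A k m = A m k" if "k < d" "m < d" for k m
    using A that by (simp add: sym_pos_def_mat_def)
  have AB: "(\<Sum>k<d. A m k * B k n) = (if m = n then 1 else 0)" if "m < d" "n < d" for m n
    using B that by (auto simp: inverse_mat_def mmul_def idmat_def)
  have "B i j = (\<Sum>m<d. if m = i then B m j else 0)"
    using ij by simp
  also have "\<dots> = (\<Sum>m<d. (\<Sum>k<d. A m k * B k i) * B m j)"
    using ij AB by (intro sum.cong) auto
  also have "\<dots> = (\<Sum>m<d. \<Sum>k<d. B k i * (A k m * B m j))"
    unfolding sum_distrib_right by (intro sum.cong) (auto simp: sym mult_ac)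
  also have "\<dots> = (\<Sum>k<d. B k i * (\<Sum>m<d. A k m * B m j))"
    by (subst sum.swap) (simp add: sum_distrib_left)
  also have "\<dots> = (\<Sum>k<d. if k = j then B k i else 0)"
    using ij AB by (intro sum.cong) auto
  also have "\<dots> = B j i" using ij by simp
  finally show ?thesis .
qed

lemma qform_eq_dotd_mvec:
  assumes "\<And>i j. i < d \<Longrightarrow> j < d \<Longrightarrow> A i j = A j i"
  shows "qform d A x z = dotd d (mvec d A x) z"
proof -
  have "qform d A x z = (\<Sum>j<d. \<Sum>i<d. x i * A i j * z j)"
    unfolding qform_def by (rule sum.swap)
  also have "\<dots> = dotd d (mvec d A x) z"
    unfolding dotd_def mvec_def sum_distrib_right
    by (intro sum.cong) (use assms in \<open>auto simp: mult_ac\<close>)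
  finally show ?thesis .
qed

lemma qform_mmul_self:
  assumes "\<And>i j. i < d \<Longrightarrow> j < d \<Longrightarrow> A i j = A j i"
  shows "qform d (mmul d A A) x y = dotd d (mvec d A x) (mvec d A y)"
proof -
  have "qform d (mmul d A A) x y = (\<Sum>i<d. \<Sum>j<d. \<Sum>k<d. (A i k * x i) * (A k j * y j))"
    by (simp add: qform_def mmul_def sum_distrib_left sum_distrib_right mult_ac)
  also have "\<dots> = (\<Sum>i<d. \<Sum>k<d. \<Sum>j<d. (A i k * x i) * (A k j * y j))"
    by (rule sum.cong[OF refl]) (rule sum.swap)
  also have "\<dots> = (\<Sum>k<d. \<Sum>i<d. \<Sum>j<d. (A i k * x i) * (A k j * y j))"
    by (rule sum.swap)
  also have "\<dots> = (\<Sum>k<d. \<Sum>i<d. \<Sum>j<d. (A k i * x i) * (A k j * y j))"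
    by (intro sum.cong refl) (use assms in auto)
  also have "\<dots> = dotd d (mvec d A x) (mvec d A y)"
    by (simp add: dotd_def mvec_def sum_product)
  finally show ?thesis .
qed

lemma qform_mpowi_0: "qform d (mpowi d Sig Om 0) z z = dotd d z z"
  by (simp add: qform_def mpowi_def idmat_def dotd_def if_distrib[of "\<lambda>t. _ * t * _"] cong: if_cong)

lemma qform_mpowi_1: "qform d (mpowi d Sig Om 1) z z = qform d Om z z"
  by (auto simp: qform_def mpowi_def mmul_def idmat_def if_distrib[of "\<lambda>t. _ * t"] cong: if_cong intro!: sum.cong)

lemma dotd_scale_left: "dotd d (\<lambda>i. c * u i) v = c * dotd d u v"
  by (simp add: dotd_def sum_distrib_left mult_ac)

lemma vnorm_scale: "vnorm d (\<lambda>i. c * u i) = \<bar>c\<bar> * vnorm d u"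
  by (simp add: vnorm_def dotd_scale real_sqrt_mult)

text \<open>Normalising \<open>a\<close> reduces this to unit vectors. If \<open>a\<close> vanishes,
  both sides are the point mass at 0.\<close>

lemma distr_linear_gaussd:
  "distr (gaussd d) borel (dotd d a) = distr std_normal borel (\<lambda>g. vnorm d a * g)"
proof (cases "vnorm d a = 0")
  case True
  then have "dotd d a a = 0" by (simp add: vnorm_def dotd_self_nonneg)
  then have "\<forall>i<d. a i = 0" by (simp add: dotd_self_eq_0_iff)
  then have "dotd d a = (\<lambda>_. 0)" by (auto simp: dotd_def)
  moreover have "(\<lambda>g. vnorm d a * g) = (\<lambda>_. 0)" using True by auto
  moreover have "distr (gaussd d) borel (\<lambda>_. 0 :: real) = distr std_normal borel (\<lambda>_. 0)"
    by (rule measure_eqI)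
      (use prob_space.emeasure_space_1[OF prob_space_std_normal]
         prob_space.emeasure_space_1[OF prob_space_gaussd] in \<open>auto simp: emeasure_distr vimage_def\<close>)
  ultimately show ?thesis by simp
next
  case False
  define n where "n = (\<lambda>i. 1 / vnorm d a * a i)"
  have n: "dotd d n n = 1"
    using False dotd_self_nonneg[of d a] by (simp only: n_def dotd_scale) (simp add: vnorm_def power_divide)
  have n_dot: "dotd d n z = 1 / vnorm d a * dotd d a z" for z
    unfolding n_def by (rule dotd_scale_left)
  have "dotd d a = (\<lambda>z. vnorm d a * dotd d n z)"
    by (rule ext) (use False in \<open>simp add: n_dot\<close>)
  then have "distr (gaussd d) borel (dotd d a)
      = distr (distr (gaussd d) borel (dotd d n)) borel (\<lambda>g. vnorm d a * g)"
    by (subst distr_distr) (auto simp: comp_def)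
  then show ?thesis by (simp add: distr_dotd_gauss[OF n])
qed

lemma mvec_eq_nvec: "i < d \<Longrightarrow> mvec d Om x i = - vnorm d (mvec d Om x) * nvec d Om x i"
  by (cases "vnorm d (mvec d Om x) = 0")
     (auto simp: nvec_def vnorm_def dotd_self_nonneg dotd_self_eq_0_iff)

text \<open>The linear part of the acceptance exponent sees only \<open>z1\<close>, the variable
  that both GCRN proposals share. The sign comes from \<open>nvec\<close> pointing against
  \<open>mvec d Om x\<close>.\<close>

lemma dotd_mvec_gcrn_z:
  "dotd d (mvec d Om x) (gcrn_z d (nvec d Om x) z z1) = - vnorm d (mvec d Om x) * z1"
proof -
  have "dotd d (mvec d Om x) w = - vnorm d (mvec d Om x) * dotd d (nvec d Om x) w" for w
    unfolding dotd_def sum_distrib_left by (intro sum.cong) (simp_all add: mvec_eq_nvec)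
  then show ?thesis
    using dotd_gcrn_z[OF nvec_unit, of d Om x] by (cases "vnorm d (mvec d Om x) = 0") auto
qed

text \<open>The bound \<open>min (f s) (f t) \<le> f (min s 0) + f (max t 0) - f 0\<close> separates the two variables
  and is an equality when \<open>s = a * g\<close>, \<open>t = b * g\<close> with \<open>a \<ge> b \<ge> 0\<close>.\<close>

lemma expectation_min_le_comonotone:
  fixes f :: "real \<Rightarrow> real"
  assumes M: "prob_space M" and N: "prob_space N" "sets N = sets borel"
    and S [measurable]: "S \<in> borel_measurable M" and T [measurable]: "T \<in> borel_measurable M"
    and dS: "distr M borel S = distr N borel (\<lambda>g. a * g)"
    and dT: "distr M borel T = distr N borel (\<lambda>g. b * g)"
    and ab: "0 \<le> a" "0 \<le> b" and f: "mono f" "\<And>r. 0 \<le> f r" "\<And>r. f r \<le> 1"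
  shows "(\<integral>w. min (f (S w)) (f (T w)) \<partial>M) \<le> (\<integral>g. min (f (a * g)) (f (b * g)) \<partial>N)"
  using ab S T dS dT
proof (induction a b arbitrary: S T rule: linorder_wlog)
  case (sym a b)
  from sym(1)[of T S] sym(2-) show ?case by (simp add: min.commute)
next
  \<comment> \<open>In this case \<open>b\<close> is the smaller factor and belongs to
    \<open>S\<close>, while \<open>a\<close> belongs to \<open>T\<close>. So \<open>T\<close> is cut
    off above at 0 and \<open>S\<close> below.\<close>
  case (le b a)
  note [measurable] = le(4,5)
  interpret M: prob_space M by fact
  interpret N: prob_space N by fact
  note [measurable_cong] = N(2)
  have [measurable]: "f \<in> borel_measurable borel" using f(1) by (rule borel_measurable_mono)
  have iM: "integrable M (\<lambda>w. f (X w))" if [measurable]: "X \<in> borel_measurable M" for X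
    using f by (intro M.integrable_const_bound[where B = 1]) auto
  have iN: "integrable N (\<lambda>w. f (X w))" if [measurable]: "X \<in> borel_measurable N" for X
    using f by (intro N.integrable_const_bound[where B = 1]) auto
  have tr: "(\<integral>w. F (X w) \<partial>M) = (\<integral>g. F (c * g) \<partial>N)"
    if "distr M borel X = distr N borel (\<lambda>g. c * g)" and [measurable]: "X \<in> borel_measurable M"
      "F \<in> borel_measurable borel" for X c and F :: "real \<Rightarrow> real"
  proof -
    have "(\<integral>w. F (X w) \<partial>M) = (\<integral>r. F r \<partial>distr M borel X)" by (subst integral_distr) auto
    also have "\<dots> = (\<integral>g. F (c * g) \<partial>N)" unfolding that(1) by (subst integral_distr) auto
    finally show ?thesis .
  qed
  have "(\<integral>w. min (f (S w)) (f (T w)) \<partial>M) \<le> (\<integral>w. f (max (S w) 0) + f (min (T w) 0) - f 0 \<partial>M)"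
  proof (rule integral_mono)
    show "integrable M (\<lambda>w. min (f (S w)) (f (T w)))" by (intro integrable_min iM) auto
    show "integrable M (\<lambda>w. f (max (S w) 0) + f (min (T w) 0) - f 0)"
      by (intro Bochner_Integration.integrable_diff Bochner_Integration.integrable_add iM) auto
    fix w
    show "min (f (S w)) (f (T w)) \<le> f (max (S w) 0) + f (min (T w) 0) - f 0"
      \<comment> \<open>If \<open>T w\<close> is at most 0, the minimum is at most
        \<open>f (T w)\<close> and \<open>f (max (S w) 0)\<close> is at least \<open>f 0\<close>;
        otherwise the minimum is at most \<open>f (S w)\<close>.\<close>
      using monoD[OF f(1), of "S w" "max (S w) 0"] monoD[OF f(1), of 0 "max (S w) 0"]
      by (cases "T w \<le> 0") (auto simp: min_def max_def)
  qed
  also have "\<dots> = (\<integral>w. f (max (S w) 0) \<partial>M) + (\<integral>w. f (min (T w) 0) \<partial>M) - f 0"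
    by (subst Bochner_Integration.integral_diff Bochner_Integration.integral_add;
        (intro Bochner_Integration.integrable_add iM)?; simp add: M.prob_space)+
  \<comment> \<open>With the variables separated only the marginal laws matter, so both can be
    expressed through one and the same \<open>g\<close>.\<close>
  also have "\<dots> = (\<integral>g. f (max (b * g) 0) \<partial>N) + (\<integral>g. f (min (a * g) 0) \<partial>N) - f 0"
    using tr[OF le(6), of "\<lambda>r. f (max r 0)"] tr[OF le(7), of "\<lambda>r. f (min r 0)"] by simp
  also have "\<dots> = (\<integral>g. f (max (b * g) 0) + f (min (a * g) 0) - f 0 \<partial>N)"
    by (subst Bochner_Integration.integral_diff Bochner_Integration.integral_add;
        (intro Bochner_Integration.integrable_add iN)?; simp add: N.prob_space)+
  also have "\<dots> = (\<integral>g. min (f (b * g)) (f (a * g)) \<partial>N)"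
  proof (rule Bochner_Integration.integral_cong)
    fix g
    show "f (max (b * g) 0) + f (min (a * g) 0) - f 0 = min (f (b * g)) (f (a * g))"
    proof (cases "g \<ge> 0")
      case True
      then have "0 \<le> b * g" "b * g \<le> a * g" using le by (auto intro: mult_right_mono)
      with monoD[OF f(1) this(2)] show ?thesis by (simp add: min_absorb1 min_absorb2 max_absorb1)
    next
      case False
      then have "b * g \<le> 0" "a * g \<le> b * g" "a * g \<le> 0"
        using le by (auto intro: mult_right_mono_neg simp: mult_le_0_iff)
      with monoD[OF f(1) this(2)] show ?thesis by (simp add: min_absorb1 min_absorb2 max_absorb2)
    qed
  qed simp
  finally show ?case .
qed

section \<open>Joint acceptance\<close>

lemma couplings_I_D:
  assumes "K \<in> couplings_I d"
  shows "prob_space K" "sets K = sets (MU \<Otimes>\<^sub>M MZ d)"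
    "distr K borel (\<lambda>w. fst (fst w)) = unif01" "distr K borel (\<lambda>w. snd (fst w)) = unif01"
    "distr K (gaussd d) (\<lambda>w. fst (snd w)) = gaussd d"
    "distr K (gaussd d) (\<lambda>w. snd (snd w)) = gaussd d"
    "K = distr K MU fst \<Otimes>\<^sub>M distr K (MZ d) snd"
  using assms by (auto simp: couplings_I_def)

lemma measurable_accept [measurable (raw)]:
  assumes [measurable]: "f \<in> borel_measurable M" "g \<in> measurable M (gaussd d)"
  shows "(\<lambda>w. accept d Om h x (f w) (g w)) \<in> borel_measurable M"
  unfolding accept_def by measurable

lemma accept_bounds: "0 \<le> accept d Om h x u z" "accept d Om h x u z \<le> 1"
  by (auto simp: accept_def)

definition accept_prob ::
  "nat \<Rightarrow> (nat \<Rightarrow> nat \<Rightarrow> real) \<Rightarrow> real \<Rightarrow> (nat \<Rightarrow> real) \<Rightarrow> (nat \<Rightarrow> real) \<Rightarrow> real" where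
  "accept_prob d Om h x z = min 1 (exp (- h * qform d Om x z - h\<^sup>2 * qform d Om z z / 2))"

lemma measurable_accept_prob [measurable (raw)]:
  assumes [measurable]: "g \<in> measurable M (gaussd d)"
  shows "(\<lambda>w. accept_prob d Om h x (g w)) \<in> borel_measurable M"
  unfolding accept_prob_def by measurable

lemma accept_prob_bounds: "0 \<le> accept_prob d Om h x z" "accept_prob d Om h x z \<le> 1"
  by (auto simp: accept_prob_def)

lemma expectation_accept: "(\<integral>u. accept d Om h x u z \<partial>unif01) = accept_prob d Om h x z"
  unfolding accept_def accept_prob_def by (rule unif01_cdf) simp

text \<open>With a common uniform the two acceptance events are nested, so their joint probability
  is the smaller of the two.\<close>

lemma expectation_accept_both:
  "(\<integral>u. accept d Om h x u z * accept d Om h y u z' \<partial>unif01)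
     = min (accept_prob d Om h x z) (accept_prob d Om h y z')"
proof -
  let ?a = "exp (- h * qform d Om x z - h\<^sup>2 * qform d Om z z / 2)"
  let ?b = "exp (- h * qform d Om y z' - h\<^sup>2 * qform d Om z' z' / 2)"
  have "(\<lambda>u. accept d Om h x u z * accept d Om h y u z') = (\<lambda>u. if u \<le> min ?a ?b then 1 else 0)"
    unfolding accept_def by auto
  then have "(\<integral>u. accept d Om h x u z * accept d Om h y u z' \<partial>unif01) = min 1 (min ?a ?b)"
    using unif01_cdf[of "min ?a ?b"] by simp
  then show ?thesis unfolding accept_prob_def by (simp add: min_def)
qed

abbreviation both_accept where
  "both_accept d Om h x y w \<equiv>
     accept d Om h x (fst (fst w)) (fst (snd w)) * accept d Om h y (snd (fst w)) (snd (snd w))"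

abbreviation min_accept_prob where
  "min_accept_prob d Om h x y p \<equiv>
     min (accept_prob d Om h x (fst p)) (accept_prob d Om h y (snd p))"

lemma measurable_MZ_components [measurable]:
  "fst \<in> measurable (MZ d) (gaussd d)" "snd \<in> measurable (MZ d) (gaussd d)"
  unfolding MZ_def by simp_all

lemma measurable_MU_components [measurable]:
  "fst \<in> borel_measurable MU" "snd \<in> borel_measurable MU"
  unfolding MU_def by simp_all

lemma integrable_both_accept:
  assumes K: "K \<in> couplings_I d"
  shows "integrable K (\<lambda>w. both_accept d Om h x y w)"
proof -
  interpret K: prob_space K by (rule couplings_I_D(1)[OF K])
  note [measurable_cong] = couplings_I_D(2)[OF K]
  show ?thesis
    by (intro K.integrable_const_bound[where B = 1])
       (auto simp: abs_mult accept_bounds intro!: mult_le_one AE_I2)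
qed

text \<open>Here the independence of uniforms and proposals enters: a coupling of the class is the
  product of its two projections, so Fubini applies.\<close>

lemma integral_both_accept:
  assumes K: "K \<in> couplings_I d"
  shows "(\<integral>w. both_accept d Om h x y w \<partial>K)
    = (\<integral>p. (\<integral>u. accept d Om h x (fst u) (fst p) * accept d Om h y (snd u) (snd p) \<partial>distr K MU fst)
         \<partial>distr K (MZ d) snd)"
    and "integrable (distr K (MZ d) snd)
      (\<lambda>p. \<integral>u. accept d Om h x (fst u) (fst p) * accept d Om h y (snd u) (snd p) \<partial>distr K MU fst)"
proof -
  note K' = couplings_I_D[OF K]
  interpret K: prob_space K by fact
  note [measurable_cong] = K'(2)
  have m: "fst \<in> measurable K MU" "snd \<in> measurable K (MZ d)" by measurable
  interpret U: prob_space "distr K MU fst" by (rule K.prob_space_distr[OF m(1)])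
  interpret Z: prob_space "distr K (MZ d) snd" by (rule K.prob_space_distr[OF m(2)])
  interpret P: pair_prob_space "distr K MU fst" "distr K (MZ d) snd" ..
  let ?F = "\<lambda>w. both_accept d Om h x y w"
  note integrable_both_accept[OF K, where Om = Om and h = h and x = x and y = y]
  then have F: "integrable (distr K MU fst \<Otimes>\<^sub>M distr K (MZ d) snd) (\<lambda>(u, p). ?F (u, p))"
    by (simp only: K'(7)[symmetric] split_def prod.collapse)
  show "integrable (distr K (MZ d) snd)
      (\<lambda>p. \<integral>u. accept d Om h x (fst u) (fst p) * accept d Om h y (snd u) (snd p) \<partial>distr K MU fst)"
    using P.integrable_snd[OF F] by simp
  have "(\<integral>w. ?F w \<partial>K) = (\<integral>w. (\<lambda>(u, p). ?F (u, p)) w \<partial>(distr K MU fst \<Otimes>\<^sub>M distr K (MZ d) snd))"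
    by (simp only: K'(7)[symmetric] split_def prod.collapse)
  also have "\<dots> = (\<integral>p. (\<integral>u. ?F (u, p) \<partial>distr K MU fst) \<partial>distr K (MZ d) snd)"
    by (rule P.integral_snd[OF F, symmetric])
  finally show "(\<integral>w. ?F w \<partial>K)
    = (\<integral>p. (\<integral>u. accept d Om h x (fst u) (fst p) * accept d Om h y (snd u) (snd p) \<partial>distr K MU fst)
         \<partial>distr K (MZ d) snd)" by simp
qed

lemma integral_min_accept_prob_snd:
  assumes K: "K \<in> couplings_I d"
  shows "(\<integral>p. min_accept_prob d Om h x y p \<partial>distr K (MZ d) snd)
      = (\<integral>w. min_accept_prob d Om h x y (snd w) \<partial>K)"
proof -
  note [measurable_cong] = couplings_I_D(2)[OF K]
  show ?thesis by (rule integral_distr) measurable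
qed

text \<open>For fixed proposals the uniforms keep their marginal laws, and an intersection of two
  events is at most as likely as either of them.\<close>

lemma both_accept_le:
  assumes K: "K \<in> couplings_I d"
  shows "(\<integral>w. both_accept d Om h x y w \<partial>K) \<le> (\<integral>w. min_accept_prob d Om h x y (snd w) \<partial>K)"
proof -
  note K' = couplings_I_D[OF K]
  interpret K: prob_space K by fact
  note [measurable_cong] = K'(2)
  have m: "fst \<in> measurable K MU" "snd \<in> measurable K (MZ d)" by measurable
  let ?U = "distr K MU fst"
  interpret U: prob_space ?U by (rule K.prob_space_distr[OF m(1)])
  interpret Z: prob_space "distr K (MZ d) snd" by (rule K.prob_space_distr[OF m(2)])
  have marg: "distr ?U borel fst = unif01" "distr ?U borel snd = unif01"
    using K'(3,4) m(1) by (simp_all add: distr_distr comp_def)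
  have i: "integrable ?U F" if "F \<in> borel_measurable ?U" "\<And>w. 0 \<le> F w" "\<And>w. F w \<le> 1" for F :: "_ \<Rightarrow> real"
    using that by (intro U.integrable_const_bound[where B = 1]) auto
  have "(\<integral>w. both_accept d Om h x y w \<partial>K) \<le> (\<integral>p. min_accept_prob d Om h x y p \<partial>distr K (MZ d) snd)"
    unfolding integral_both_accept(1)[OF K]
  proof (rule integral_mono[OF integral_both_accept(2)[OF K]])
    show "integrable (distr K (MZ d) snd) (\<lambda>p. min_accept_prob d Om h x y p)"
      by (intro Z.integrable_const_bound[where B = 1]) (auto simp: accept_prob_bounds min_def)
    fix p assume "p \<in> space (distr K (MZ d) snd)"
    then have [measurable]: "fst p \<in> space (gaussd d)" "snd p \<in> space (gaussd d)"
      by (auto simp: MZ_def space_pair_measure)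
    let ?A = "\<lambda>u. accept d Om h x (fst u) (fst p)" and ?B = "\<lambda>u. accept d Om h y (snd u) (snd p)"
    have iAB: "integrable ?U ?A" "integrable ?U ?B" "integrable ?U (\<lambda>u. ?A u * ?B u)"
      by (rule i; auto simp: accept_bounds intro: mult_le_one)+
    have "(\<integral>u. ?A u * ?B u \<partial>?U) \<le> (\<integral>u. ?A u \<partial>?U)" "(\<integral>u. ?A u * ?B u \<partial>?U) \<le> (\<integral>u. ?B u \<partial>?U)"
      by (rule integral_mono; auto simp: iAB accept_bounds mult_left_le mult_left_le_one_le)+
    moreover have "(\<integral>u. ?A u \<partial>?U) = (\<integral>u. accept d Om h x u (fst p) \<partial>distr ?U borel fst)"
      by (rule integral_distr[symmetric]) measurable
    moreover have "(\<integral>u. ?B u \<partial>?U) = (\<integral>u. accept d Om h y u (snd p) \<partial>distr ?U borel snd)"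
      by (rule integral_distr[symmetric]) measurable
    ultimately show "(\<integral>u. ?A u * ?B u \<partial>?U) \<le> min_accept_prob d Om h x y p"
      by (simp add: marg expectation_accept)
  qed
  then show ?thesis by (simp add: integral_min_accept_prob_snd[OF K])
qed

lemma both_accept_gcrn:
  "(\<integral>w. both_accept d Om h x y w \<partial>gcrn_coupling d Om x y)
     = (\<integral>w. min_accept_prob d Om h x y (snd w) \<partial>gcrn_coupling d Om x y)"
proof -
  let ?K = "gcrn_coupling d Om x y"
  have "(\<integral>w. both_accept d Om h x y w \<partial>?K) = (\<integral>p. min_accept_prob d Om h x y p \<partial>distr ?K (MZ d) snd)"
    unfolding integral_both_accept(1)[OF gcrn_coupling_in_couplings_I]
  proof (rule Bochner_Integration.integral_cong[OF refl])
    fix p assume "p \<in> space (distr ?K (MZ d) snd)"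
    then have [measurable]: "fst p \<in> space (gaussd d)" "snd p \<in> space (gaussd d)"
      by (auto simp: MZ_def space_pair_measure)
    have u: "(\<lambda>u. (u, u)) \<in> measurable unif01 MU" unfolding MU_def by measurable
    show "(\<integral>u. accept d Om h x (fst u) (fst p) * accept d Om h y (snd u) (snd p) \<partial>distr ?K MU fst)
        = min_accept_prob d Om h x y p"
      unfolding distr_gcrn_coupling_fst
      by (subst integral_distr[OF u]) (auto simp: expectation_accept_both)
  qed
  then show ?thesis by (simp add: integral_min_accept_prob_snd[OF gcrn_coupling_in_couplings_I])
qed

section \<open>Joint acceptance with the quadratic term frozen\<close>

text \<open>The joint acceptance probability when one standard normal drives both chains with scales
  \<open>a\<close> and \<open>b\<close>, and the quadratic part of both exponents is the constant
  \<open>c\<close>.\<close>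

definition limit_accept :: "real \<Rightarrow> real \<Rightarrow> real \<Rightarrow> real" where
  "limit_accept c a b = (\<integral>g. min (min 1 (exp (a * g - c))) (min 1 (exp (b * g - c))) \<partial>std_normal)"

text \<open>Only the linear part of the log acceptance ratio; the quadratic part concentrates and is
  treated as a constant.\<close>

abbreviation log_ratio where "log_ratio d Om h x z \<equiv> - h * qform d Om x z"

text \<open>Each proposal has law \<open>gaussd d\<close> under every coupling, and by symmetry of
  \<open>Om\<close> the expression is a linear form whose coefficient vector has norm
  \<open>h * vnorm d (mvec d Om x)\<close>.\<close>

lemma distr_log_ratio:
  assumes K: "K \<in> couplings_I d" and h: "0 \<le> h"
    and Om: "\<And>i j. i < d \<Longrightarrow> j < d \<Longrightarrow> Om i j = Om j i"
  shows "distr K borel (\<lambda>w. log_ratio d Om h x (fst (snd w)))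
       = distr std_normal borel (\<lambda>g. h * vnorm d (mvec d Om x) * g)" (is "?fst")
    and "distr K borel (\<lambda>w. log_ratio d Om h x (snd (snd w)))
       = distr std_normal borel (\<lambda>g. h * vnorm d (mvec d Om x) * g)" (is "?snd")
proof -
  note K' = couplings_I_D[OF K]
  note [measurable_cong] = K'(2)
  let ?a = "\<lambda>i. - h * mvec d Om x i"
  have S: "log_ratio d Om h x z = dotd d ?a z" for z
    by (simp only: qform_eq_dotd_mvec[OF Om] dotd_scale_left)
  have m: "dotd d ?a \<in> borel_measurable (gaussd d)"
    by (intro measurable_dotd_const measurable_ident_sets) simp
  have law: "distr (gaussd d) borel (dotd d ?a) = distr std_normal borel (\<lambda>g. h * vnorm d (mvec d Om x) * g)"
    using h by (simp only: distr_linear_gaussd vnorm_scale abs_minus_cancel abs_of_nonneg)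
  have "distr K borel (\<lambda>w. log_ratio d Om h x (fst (snd w)))
      = distr (distr K (gaussd d) (\<lambda>w. fst (snd w))) borel (dotd d ?a)"
    unfolding S by (subst distr_distr[OF m]) (auto simp: comp_def)
  then show ?fst by (simp only: K'(5,6) law)
  have "distr K borel (\<lambda>w. log_ratio d Om h x (snd (snd w)))
      = distr (distr K (gaussd d) (\<lambda>w. snd (snd w))) borel (dotd d ?a)"
    unfolding S by (subst distr_distr[OF m]) (auto simp: comp_def)
  then show ?snd by (simp only: K'(5,6) law)
qed

abbreviation min_limit_accept where
  "min_limit_accept d Om h c x y p \<equiv>
     min (min 1 (exp (log_ratio d Om h x (fst p) - c))) (min 1 (exp (log_ratio d Om h y (snd p) - c)))"

text \<open>The comonotone bound asks only for the two marginal laws, which all couplings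
  share.\<close>

lemma min_limit_accept_le:
  assumes K: "K \<in> couplings_I d" and h: "0 \<le> h"
    and Om: "\<And>i j. i < d \<Longrightarrow> j < d \<Longrightarrow> Om i j = Om j i"
  shows "(\<integral>w. min_limit_accept d Om h c x y (snd w) \<partial>K)
     \<le> limit_accept c (h * vnorm d (mvec d Om x)) (h * vnorm d (mvec d Om y))"
  unfolding limit_accept_def
proof (rule expectation_min_le_comonotone[where f = "\<lambda>r. min 1 (exp (r - c))"])
  note K' = couplings_I_D[OF K]
  note [measurable_cong] = K'(2)
  show "prob_space K" by fact
  show "(\<lambda>w. log_ratio d Om h x (fst (snd w))) \<in> borel_measurable K"
    "(\<lambda>w. log_ratio d Om h y (snd (snd w))) \<in> borel_measurable K" by measurable
  show "mono (\<lambda>r. min 1 (exp (r - c)))" by (auto simp: mono_def min_def)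
  show "0 \<le> h * vnorm d (mvec d Om x)" "0 \<le> h * vnorm d (mvec d Om y)"
    using h by (simp_all add: vnorm_def dotd_self_nonneg)
qed (use distr_log_ratio[OF K h Om] in auto)

lemma log_ratio_gcrn_z:
  assumes "\<And>i j. i < d \<Longrightarrow> j < d \<Longrightarrow> Om i j = Om j i"
  shows "log_ratio d Om h x (gcrn_z d (nvec d Om x) z z1) = h * vnorm d (mvec d Om x) * z1"
  by (simp only: qform_eq_dotd_mvec[OF assms] dotd_mvec_gcrn_z)

text \<open>Both linear parts are nonrandom multiples of the same \<open>z1\<close>, so the
  right-hand side of the comonotone bound is attained exactly.\<close>

lemma min_limit_accept_gcrn:
  assumes Om: "\<And>i j. i < d \<Longrightarrow> j < d \<Longrightarrow> Om i j = Om j i"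
  shows "(\<integral>w. min_limit_accept d Om h c x y (snd w) \<partial>gcrn_coupling d Om x y)
     = limit_accept c (h * vnorm d (mvec d Om x)) (h * vnorm d (mvec d Om y))"
proof -
  let ?K = "gcrn_coupling d Om x y"
  let ?Q = "std_normal \<Otimes>\<^sub>M gaussd d"
  let ?g = "\<lambda>(z1, z). (gcrn_z d (nvec d Om x) z z1, gcrn_z d (nvec d Om y) z z1)"
  let ?f = "\<lambda>z1. min (min 1 (exp (h * vnorm d (mvec d Om x) * z1 - c)))
     (min 1 (exp (h * vnorm d (mvec d Om y) * z1 - c)))"
  note [measurable_cong] = couplings_I_D(2)[OF gcrn_coupling_in_couplings_I, of d Om x y]
  have g: "?g \<in> measurable ?Q (MZ d)" unfolding MZ_def by measurable
  have "(\<integral>w. min_limit_accept d Om h c x y (snd w) \<partial>?K)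
      = (\<integral>p. min_limit_accept d Om h c x y p \<partial>distr ?K (MZ d) snd)"
    by (rule integral_distr[symmetric]) measurable
  also have "\<dots> = (\<integral>q. min_limit_accept d Om h c x y (?g q) \<partial>?Q)"
    unfolding distr_gcrn_coupling_snd by (rule integral_distr[OF g]) measurable
  also have "\<dots> = (\<integral>q. ?f (fst q) \<partial>?Q)"
    by (intro Bochner_Integration.integral_cong refl)
       (simp only: split_beta fst_conv snd_conv log_ratio_gcrn_z[OF Om])
  also have "\<dots> = (\<integral>z1. ?f z1 \<partial>distr ?Q std_normal fst)"
    by (rule integral_distr[symmetric]) measurable
  finally show ?thesis by (simp only: distr_gauss_fst limit_accept_def)
qed

section \<open>Cost of freezing the quadratic term\<close>

lemma measurable_quadratic:
  "(\<lambda>z. qform d A z z) \<in> borel_measurable (gaussd d)"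
  by (intro measurable_qform measurable_ident_sets) simp

lemma integrable_qform: "integrable (gaussd d) (\<lambda>z. qform d A z z)"
proof -
  interpret prob_space "gaussd d" by simp
  show ?thesis by (rule square_integrable_imp_integrable[OF measurable_quadratic integrable_qform_squared])
qed

text \<open>Errors that involve one proposal at a time are thereby evaluated under
  \<open>gaussd d\<close>, with the same value for all couplings.\<close>

lemma integrable_marginals:
  fixes F :: "(nat \<Rightarrow> real) \<Rightarrow> real"
  assumes K: "K \<in> couplings_I d" and F: "integrable (gaussd d) F"
  shows "integrable K (\<lambda>w. F (fst (snd w)))" "integrable K (\<lambda>w. F (snd (snd w)))"
    "(\<integral>w. F (fst (snd w)) \<partial>K) = (\<integral>z. F z \<partial>gaussd d)"
    "(\<integral>w. F (snd (snd w)) \<partial>K) = (\<integral>z. F z \<partial>gaussd d)"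
proof -
  note K' = couplings_I_D[OF K]
  note [measurable_cong] = K'(2)
  have m: "(\<lambda>w. fst (snd w)) \<in> measurable K (gaussd d)" "(\<lambda>w. snd (snd w)) \<in> measurable K (gaussd d)"
    by measurable
  note Fm = borel_measurable_integrable[OF F]
  show "integrable K (\<lambda>w. F (fst (snd w)))"
    using F integrable_distr_eq[OF m(1) Fm] by (simp add: K'(5,6))
  show "integrable K (\<lambda>w. F (snd (snd w)))"
    using F integrable_distr_eq[OF m(2) Fm] by (simp add: K'(5,6))
  show "(\<integral>w. F (fst (snd w)) \<partial>K) = (\<integral>z. F z \<partial>gaussd d)"
    using integral_distr[OF m(1) Fm] by (simp add: K'(5,6))
  show "(\<integral>w. F (snd (snd w)) \<partial>K) = (\<integral>z. F z \<partial>gaussd d)"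
    using integral_distr[OF m(2) Fm] by (simp add: K'(5,6))
qed

lemma accept_prob_approx:
  "\<bar>accept_prob d Om h x z - min 1 (exp (log_ratio d Om h x z - c))\<bar>
     \<le> \<bar>h\<^sup>2 * qform d Om z z / 2 - c\<bar>"
  unfolding accept_prob_def by (rule order_trans[OF min_exp_lipschitz]) simp

text \<open>The minimum moves by at most the sum of the changes of its two arguments; the factor 2
  counts the two proposals.\<close>

lemma min_accept_prob_approx:
  assumes K: "K \<in> couplings_I d"
  shows "\<bar>(\<integral>w. min_accept_prob d Om h x y (snd w) \<partial>K)
        - (\<integral>w. min_limit_accept d Om h c x y (snd w) \<partial>K)\<bar>
      \<le> 2 * (\<integral>z. \<bar>h\<^sup>2 * qform d Om z z / 2 - c\<bar> \<partial>gaussd d)"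
proof -
  note K' = couplings_I_D[OF K]
  interpret K: prob_space K by fact
  interpret G: prob_space "gaussd d" by simp
  note [measurable_cong] = K'(2)
  let ?F = "\<lambda>z. \<bar>h\<^sup>2 * qform d Om z z / 2 - c\<bar>"
  have F: "integrable (gaussd d) ?F"
    by (intro integrable_abs Bochner_Integration.integrable_diff integrable_divide
        integrable_mult_right integrable_qform) simp
  note FK = integrable_marginals[OF K F]
  have i: "integrable K (\<lambda>w. min_accept_prob d Om h x y (snd w))"
    by (intro K.integrable_const_bound[where B = 1]) (auto simp: accept_prob_bounds min_def)
  have j: "integrable K (\<lambda>w. min_limit_accept d Om h c x y (snd w))"
  proof (rule K.integrable_const_bound[where B = 1])
    have "0 \<le> min (min 1 (exp a)) (min 1 (exp b))" "min (min 1 (exp a)) (min 1 (exp b)) \<le> 1"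
      for a b :: real by (simp_all add: min_le_iff_disj)
    then show "AE w in K. norm (min_limit_accept d Om h c x y (snd w)) \<le> 1"
      by (intro AE_I2) (simp only: real_norm_def abs_of_nonneg)
  qed measurable
  have "\<bar>\<integral>w. min_accept_prob d Om h x y (snd w) - min_limit_accept d Om h c x y (snd w) \<partial>K\<bar>
      \<le> (\<integral>w. ?F (fst (snd w)) + ?F (snd (snd w)) \<partial>K)"
  proof (rule order_trans[OF integral_abs_bound integral_mono])
    show "integrable K (\<lambda>w. \<bar>min_accept_prob d Om h x y (snd w) - min_limit_accept d Om h c x y (snd w)\<bar>)"
      by (intro integrable_abs Bochner_Integration.integrable_diff i j)
    show "integrable K (\<lambda>w. ?F (fst (snd w)) + ?F (snd (snd w)))"
      by (intro Bochner_Integration.integrable_add FK)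
    have min_diff: "\<bar>min p q - min p' q'\<bar> \<le> \<bar>p - p'\<bar> + \<bar>q - q'\<bar>" for p q p' q' :: real
      by (auto simp: min_def)
    fix w
    show "\<bar>min_accept_prob d Om h x y (snd w) - min_limit_accept d Om h c x y (snd w)\<bar>
        \<le> ?F (fst (snd w)) + ?F (snd (snd w))"
      by (rule order_trans[OF min_diff add_mono[OF accept_prob_approx accept_prob_approx]])
  qed
  also have "\<dots> = 2 * (\<integral>z. ?F z \<partial>gaussd d)"
    by (simp add: FK Bochner_Integration.integral_add)
  finally show ?thesis by (simp only: Bochner_Integration.integral_diff[OF i j])
qed

section \<open>Cross increments\<close>

text \<open>The constant 4 comes from bounding the square of a difference by twice the sum of the
  squares, both of which have mean 1. It does not grow with \<open>d\<close>.\<close>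

lemma gcrn_shift_second_moment:
  fixes n :: "nat \<Rightarrow> real"
  assumes n: "dotd d n n = 1 \<or> (\<forall>i<d. n i = 0)"
  shows "integrable (std_normal \<Otimes>\<^sub>M gaussd d) (\<lambda>(z1, z). (z1 - dotd d n z)\<^sup>2 * dotd d n n)" (is ?int)
    and "(\<integral>q. (\<lambda>(z1, z). (z1 - dotd d n z)\<^sup>2 * dotd d n n) q \<partial>(std_normal \<Otimes>\<^sub>M gaussd d)) \<le> 4" (is ?le)
proof -
  let ?Q = "std_normal \<Otimes>\<^sub>M gaussd d"
  have "?int \<and> ?le"
    using n
  proof
    assume "\<forall>i<d. n i = 0"
    then have "dotd d n n = 0" by (simp add: dotd_self_eq_0_iff)
    then show ?thesis by (simp add: case_prod_beta')
  next
    assume n: "dotd d n n = 1"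
    have m: "dotd d n \<in> borel_measurable (gaussd d)"
      by (intro measurable_dotd_const measurable_ident_sets) simp
    have fst: "integrable ?Q (\<lambda>q. (fst q)\<^sup>2)" "(\<integral>q. (fst q)\<^sup>2 \<partial>?Q) = 1"
    proof -
      have mf: "fst \<in> measurable ?Q std_normal" by simp
      have mp: "(\<lambda>x. x\<^sup>2) \<in> borel_measurable std_normal" by measurable
      show "integrable ?Q (\<lambda>q. (fst q)\<^sup>2)"
        using integrable_distr_eq[OF mf mp] by (simp add: distr_gauss_fst)
      show "(\<integral>q. (fst q)\<^sup>2 \<partial>?Q) = 1"
        using integral_distr[OF mf mp] by (simp add: distr_gauss_fst std_normal_second_moment)
    qed
    have snd: "integrable ?Q (\<lambda>q. (dotd d n (snd q))\<^sup>2)" "(\<integral>q. (dotd d n (snd q))\<^sup>2 \<partial>?Q) = 1"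
    proof -
      have ms: "(\<lambda>q. dotd d n (snd q)) \<in> borel_measurable ?Q" by measurable
      have "distr ?Q borel (\<lambda>q. dotd d n (snd q)) = distr (distr ?Q (gaussd d) snd) borel (dotd d n)"
        by (subst distr_distr[OF m]) (auto simp: comp_def)
      then have D: "distr ?Q borel (\<lambda>q. dotd d n (snd q)) = std_normal"
        by (simp add: distr_gauss_snd distr_dotd_gauss[OF n])
      have mp: "(\<lambda>x. x\<^sup>2) \<in> borel_measurable (borel :: real measure)" by measurable
      show "integrable ?Q (\<lambda>q. (dotd d n (snd q))\<^sup>2)"
        using integrable_distr_eq[OF ms mp] by (simp add: D)
      show "(\<integral>q. (dotd d n (snd q))\<^sup>2 \<partial>?Q) = 1"
        using integral_distr[OF ms mp] by (simp add: D std_normal_second_moment)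
    qed
    have b: "(fst q - dotd d n (snd q))\<^sup>2 \<le> 2 * (fst q)\<^sup>2 + 2 * (dotd d n (snd q))\<^sup>2" for q
      using zero_le_power2[of "fst q + dotd d n (snd q)"] by (simp add: power2_eq_square algebra_simps)
    have ib: "integrable ?Q (\<lambda>q. 2 * (fst q)\<^sup>2 + 2 * (dotd d n (snd q))\<^sup>2)"
      by (intro Bochner_Integration.integrable_add integrable_mult_right fst snd)
    have i: "integrable ?Q (\<lambda>q. (fst q - dotd d n (snd q))\<^sup>2)"
      by (rule Bochner_Integration.integrable_bound[OF ib]) (auto intro!: AE_I2 order_trans[OF b])
    have "(\<integral>q. (fst q - dotd d n (snd q))\<^sup>2 \<partial>?Q) \<le> (\<integral>q. 2 * (fst q)\<^sup>2 + 2 * (dotd d n (snd q))\<^sup>2 \<partial>?Q)"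
      by (rule integral_mono[OF i ib b])
    also have "\<dots> = 4"
      by (simp add: fst snd Bochner_Integration.integral_add)
    finally show ?thesis using i n by (simp add: case_prod_beta')
  qed
  then show ?int ?le by blast+
qed

abbreviation sq_dist where "sq_dist d u v \<equiv> dotd d (\<lambda>i. u i - v i) (\<lambda>i. u i - v i)"

lemma measurable_sq_dist [measurable (raw)]:
  assumes f: "f \<in> measurable M (gaussd d)" and g: "g \<in> measurable M (gaussd d)"
  shows "(\<lambda>w. sq_dist d (f w) (g w)) \<in> borel_measurable M"
  unfolding dotd_def
  by (intro borel_measurable_sum borel_measurable_times borel_measurable_diff
      measurable_gaussd_component[OF f] measurable_gaussd_component[OF g]) auto

text \<open>The common \<open>z\<close> cancels in the difference of the proposals, leaving only the
  two displacements along \<open>n\<close> and \<open>n'\<close>.\<close>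

lemma sq_dist_gcrn_z_le:
  "sq_dist d (gcrn_z d n z z1) (gcrn_z d n' z z1)
     \<le> 2 * ((z1 - dotd d n z)\<^sup>2 * dotd d n n) + 2 * ((z1 - dotd d n' z)\<^sup>2 * dotd d n' n')"
proof -
  let ?p = "z1 - dotd d n z" and ?q = "z1 - dotd d n' z"
  have "sq_dist d (gcrn_z d n z z1) (gcrn_z d n' z z1) = (\<Sum>i<d. (?p * n i - ?q * n' i)\<^sup>2)"
    unfolding dotd_def[of d "\<lambda>i. gcrn_z d n z z1 i - gcrn_z d n' z z1 i"]
    by (simp add: gcrn_z_eq power2_eq_square)
  also have "\<dots> \<le> (\<Sum>i<d. 2 * (?p\<^sup>2 * (n i * n i)) + 2 * (?q\<^sup>2 * (n' i * n' i)))"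
  proof (rule sum_mono)
    fix i
    show "(?p * n i - ?q * n' i)\<^sup>2 \<le> 2 * (?p\<^sup>2 * (n i * n i)) + 2 * (?q\<^sup>2 * (n' i * n' i))"
      using zero_le_power2[of "?p * n i + ?q * n' i"]
      by (simp only: power2_sum power2_diff power_mult_distrib power2_eq_square[of "n i", symmetric]
            power2_eq_square[of "n' i", symmetric])
  qed
  also have "\<dots> = 2 * (?p\<^sup>2 * dotd d n n) + 2 * (?q\<^sup>2 * dotd d n' n')"
    by (simp add: sum.distrib sum_distrib_left dotd_def[of d n n] dotd_def[of d n' n'])
  finally show ?thesis .
qed

text \<open>The bound is twice 4 for each displacement, uniformly in the dimension, so
  multiplication by \<open>h^2\<close> of order \<open>1 / d\<close> makes it vanish.\<close>

lemma sq_dist_gcrn: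
  shows "integrable (gcrn_coupling d Om x y) (\<lambda>w. sq_dist d (fst (snd w)) (snd (snd w)))" (is ?int)
    and "(\<integral>w. sq_dist d (fst (snd w)) (snd (snd w)) \<partial>gcrn_coupling d Om x y) \<le> 16" (is ?le)
proof -
  let ?K = "gcrn_coupling d Om x y"
  let ?Q = "std_normal \<Otimes>\<^sub>M gaussd d"
  let ?n = "nvec d Om x" and ?n' = "nvec d Om y"
  let ?g = "\<lambda>(z1, z). (gcrn_z d ?n z z1, gcrn_z d ?n' z z1)"
  let ?S = "\<lambda>n (z1, z). (z1 - dotd d n z)\<^sup>2 * dotd d n n"
  let ?D = "\<lambda>p. sq_dist d (fst p) (snd p)"
  note [measurable_cong] = couplings_I_D(2)[OF gcrn_coupling_in_couplings_I, of d Om x y]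
  have g: "?g \<in> measurable ?Q (MZ d)" unfolding MZ_def by measurable
  have s: "snd \<in> measurable ?K (MZ d)" by measurable
  have D: "?D \<in> borel_measurable (MZ d)" by measurable
  note S = gcrn_shift_second_moment[OF nvec_cases[of d Om x]] gcrn_shift_second_moment[OF nvec_cases[of d Om y]]
  have iB: "integrable ?Q (\<lambda>q. 2 * ?S ?n q + 2 * ?S ?n' q)"
    by (intro Bochner_Integration.integrable_add integrable_mult_right S)
  have le: "?D (?g q) \<le> 2 * ?S ?n q + 2 * ?S ?n' q" for q
    using sq_dist_gcrn_z_le by (cases q) auto
  have iD: "integrable ?Q (\<lambda>q. ?D (?g q))"
  proof (rule Bochner_Integration.integrable_bound[OF iB])
    show "(\<lambda>q. ?D (?g q)) \<in> borel_measurable ?Q" by (rule measurable_compose[OF g D])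
    show "AE q in ?Q. norm (?D (?g q)) \<le> norm (2 * ?S ?n q + 2 * ?S ?n' q)"
    proof (rule AE_I2)
      fix q
      have "0 \<le> ?D (?g q)" by (rule dotd_self_nonneg)
      with le[of q] show "norm (?D (?g q)) \<le> norm (2 * ?S ?n q + 2 * ?S ?n' q)"
        unfolding real_norm_def by linarith
    qed
  qed
  then show ?int
    using integrable_distr_eq[OF s D] integrable_distr_eq[OF g D]
    by (simp add: distr_gcrn_coupling_snd)
  have "(\<integral>w. ?D (snd w) \<partial>?K) = (\<integral>q. ?D (?g q) \<partial>?Q)"
    using integral_distr[OF s D] integral_distr[OF g D] by (simp add: distr_gcrn_coupling_snd)
  also have "\<dots> \<le> (\<integral>q. 2 * ?S ?n q + 2 * ?S ?n' q \<partial>?Q)"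
    by (rule integral_mono[OF iD iB le])
  also have "\<dots> = 2 * (\<integral>q. ?S ?n q \<partial>?Q) + 2 * (\<integral>q. ?S ?n' q \<partial>?Q)"
    using S(1,3) by (subst Bochner_Integration.integral_add) (auto simp del: split_beta)
  also have "\<dots> \<le> 16" using S(2,4) by linarith
  finally show ?le .
qed

lemma dotd_polarization: "dotd d u v = (dotd d u u + dotd d v v - sq_dist d u v) / 2"
  by (simp add: dotd_def algebra_simps sum.distrib sum_subtractf sum_distrib_left)

lemma integrable_dotd_self: "integrable (gaussd d) (\<lambda>z. dotd d z z)"
  \<comment> \<open>The zeroth power is the identity matrix for any matrices, so
    \<open>undefined\<close> can fill their places.\<close>
  using integrable_qform[of d "mpowi d undefined undefined 0"] by (simp only: qform_mpowi_0)

lemma integrable_norm_error: "integrable (gaussd d) (\<lambda>z. \<bar>h\<^sup>2 * dotd d z z - s\<bar>)"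
proof -
  interpret prob_space "gaussd d" by simp
  show ?thesis
    by (intro integrable_abs Bochner_Integration.integrable_diff integrable_mult_right
        integrable_dotd_self) simp
qed

lemma cross_incr_eq:
  "cross_incr d Om h x y w = h\<^sup>2 * dotd d (fst (snd w)) (snd (snd w)) * both_accept d Om h x y w"
  by (simp add: cross_incr_def case_prod_beta mult_ac)

lemma integrable_cross_incr:
  assumes K: "K \<in> couplings_I d"
  shows "integrable K (cross_incr d Om h x y)"
proof (rule Bochner_Integration.integrable_bound)
  note [measurable_cong] = couplings_I_D(2)[OF K]
  let ?B = "\<lambda>w. h\<^sup>2 * (dotd d (fst (snd w)) (fst (snd w)) + dotd d (snd (snd w)) (snd (snd w)))"
  show "integrable K ?B"
    by (intro integrable_mult_right Bochner_Integration.integrable_add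
        integrable_marginals[OF K integrable_dotd_self])
  show "cross_incr d Om h x y \<in> borel_measurable K"
    unfolding cross_incr_eq[abs_def] by measurable
  show "AE w in K. norm (cross_incr d Om h x y w) \<le> norm (?B w)"
  proof (rule AE_I2)
    fix w :: "(real \<times> real) \<times> (nat \<Rightarrow> real) \<times> (nat \<Rightarrow> real)"
    let ?u = "fst (snd w)" and ?v = "snd (snd w)"
    have b: "0 \<le> both_accept d Om h x y w" "both_accept d Om h x y w \<le> 1"
      by (auto simp: accept_bounds mult_le_one)
    have "0 \<le> dotd d (\<lambda>i. ?u i + ?v i) (\<lambda>i. ?u i + ?v i)" by (rule dotd_self_nonneg)
    also have "\<dots> = dotd d ?u ?u + dotd d ?v ?v + 2 * dotd d ?u ?v"
      by (simp add: dotd_def algebra_simps sum.distrib sum_distrib_left)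
    \<comment> \<open>The two signs come from nonnegativity of the squared norms of the sum and of
      the difference.\<close>
    finally have "\<bar>dotd d ?u ?v\<bar> \<le> dotd d ?u ?u + dotd d ?v ?v"
      using dotd_polarization[of d ?u ?v] dotd_self_nonneg[of d "\<lambda>i. ?u i - ?v i"]
        dotd_self_nonneg[of d ?u] dotd_self_nonneg[of d ?v]
      by (auto simp: abs_le_iff field_simps)
    then have "h\<^sup>2 * \<bar>dotd d ?u ?v\<bar> * both_accept d Om h x y w \<le> ?B w * 1"
      using b dotd_self_nonneg[of d ?u] dotd_self_nonneg[of d ?v]
      by (intro mult_mono mult_left_mono mult_nonneg_nonneg add_nonneg_nonneg accept_bounds) auto
    then show "norm (cross_incr d Om h x y w) \<le> norm (?B w)"
      using dotd_self_nonneg[of d ?u] dotd_self_nonneg[of d ?v]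
      by (simp add: cross_incr_eq abs_mult abs_of_nonneg[OF accept_bounds(1)])
  qed
qed

text \<open>In both estimates the polarization identity replaces \<open>h\<^sup>2 * dotd d z\<^sub>x z\<^sub>y\<close> by
  the concentrating norms; the squared distance can be dropped in the upper one.\<close>

lemma cross_incr_upper:
  assumes K: "K \<in> couplings_I d" and h: "0 \<le> h" and s: "0 \<le> s"
    and Om: "\<And>i j. i < d \<Longrightarrow> j < d \<Longrightarrow> Om i j = Om j i"
  shows "(\<integral>w. cross_incr d Om h x y w \<partial>K)
    \<le> s * (limit_accept c (h * vnorm d (mvec d Om x)) (h * vnorm d (mvec d Om y))
           + 2 * (\<integral>z. \<bar>h\<^sup>2 * qform d Om z z / 2 - c\<bar> \<partial>gaussd d))
      + (\<integral>z. \<bar>h\<^sup>2 * dotd d z z - s\<bar> \<partial>gaussd d)"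
proof -
  let ?E = "\<lambda>z. \<bar>h\<^sup>2 * dotd d z z - s\<bar>"
  note E = integrable_marginals[OF K integrable_norm_error[where d = d and h = h and s = s]]
  note BB = integrable_both_accept[OF K, where Om = Om and h = h and x = x and y = y]
  have "(\<integral>w. cross_incr d Om h x y w \<partial>K)
      \<le> (\<integral>w. s * both_accept d Om h x y w + (?E (fst (snd w)) / 2 + ?E (snd (snd w)) / 2) \<partial>K)"
  proof (rule integral_mono[OF integrable_cross_incr[OF K]])
    show "integrable K (\<lambda>w. s * both_accept d Om h x y w + (?E (fst (snd w)) / 2 + ?E (snd (snd w)) / 2))"
      by (intro Bochner_Integration.integrable_add integrable_mult_right integrable_divide E BB)
    fix w :: "(real \<times> real) \<times> (nat \<Rightarrow> real) \<times> (nat \<Rightarrow> real)"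
    let ?u = "fst (snd w)" and ?v = "snd (snd w)" and ?b = "both_accept d Om h x y w"
    have b: "0 \<le> ?b" "?b \<le> 1" by (auto simp: accept_bounds mult_le_one)
    have "h\<^sup>2 * dotd d ?u ?v \<le> s + ((h\<^sup>2 * dotd d ?u ?u - s) / 2 + (h\<^sup>2 * dotd d ?v ?v - s) / 2)"
      using mult_nonneg_nonneg[OF zero_le_power2[of h] dotd_self_nonneg[of d "\<lambda>i. ?u i - ?v i"]]
      by (subst dotd_polarization) (simp add: field_simps)
    also have "\<dots> \<le> s + (?E ?u / 2 + ?E ?v / 2)" by (intro add_mono divide_right_mono) auto
    finally have "h\<^sup>2 * dotd d ?u ?v * ?b \<le> (s + (?E ?u / 2 + ?E ?v / 2)) * ?b"
      by (rule mult_right_mono[OF _ b(1)])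
    \<comment> \<open>The deviations are nonnegative, so their weight \<open>?b\<close> is dropped.
      What remains of the error are functions of one proposal each.\<close>
    also have "\<dots> \<le> s * ?b + (?E ?u / 2 + ?E ?v / 2)"
      using mult_left_mono[OF b(2), of "?E ?u / 2 + ?E ?v / 2"] by (simp add: ring_distribs)
    finally show "cross_incr d Om h x y w \<le> s * ?b + (?E ?u / 2 + ?E ?v / 2)"
      unfolding cross_incr_eq .
  qed
  also have "\<dots> = s * (\<integral>w. both_accept d Om h x y w \<partial>K) + (\<integral>z. ?E z \<partial>gaussd d)"
    using E BB by (simp add: Bochner_Integration.integral_add)
  also have "(\<integral>w. both_accept d Om h x y w \<partial>K)
      \<le> limit_accept c (h * vnorm d (mvec d Om x)) (h * vnorm d (mvec d Om y))
           + 2 * (\<integral>z. \<bar>h\<^sup>2 * qform d Om z z / 2 - c\<bar> \<partial>gaussd d)"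
    using both_accept_le[OF K, where Om = Om and h = h and x = x and y = y] min_accept_prob_approx[OF K, where Om = Om and h = h and x = x and y = y and c = c]
      min_limit_accept_le[where Om = Om and c = c and x = x and y = y, OF K h Om] by linarith
  finally show ?thesis using s by (simp add: mult_left_mono)
qed

lemma cross_incr_gcrn_lower:
  assumes s: "0 \<le> s"
    and Om: "\<And>i j. i < d \<Longrightarrow> j < d \<Longrightarrow> Om i j = Om j i"
  shows "s * (limit_accept c (h * vnorm d (mvec d Om x)) (h * vnorm d (mvec d Om y))
           - 2 * (\<integral>z. \<bar>h\<^sup>2 * qform d Om z z / 2 - c\<bar> \<partial>gaussd d))
      - (\<integral>z. \<bar>h\<^sup>2 * dotd d z z - s\<bar> \<partial>gaussd d) - 8 * h\<^sup>2
    \<le> (\<integral>w. cross_incr d Om h x y w \<partial>gcrn_coupling d Om x y)"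
proof -
  let ?K = "gcrn_coupling d Om x y"
  have K: "?K \<in> couplings_I d" by (rule gcrn_coupling_in_couplings_I)
  let ?E = "\<lambda>z. \<bar>h\<^sup>2 * dotd d z z - s\<bar>"
  let ?D = "\<lambda>w. sq_dist d (fst (snd w)) (snd (snd w))"
  note E = integrable_marginals[OF K integrable_norm_error[where d = d and h = h and s = s]]
  note BB = integrable_both_accept[OF K, where Om = Om and h = h and x = x and y = y]
  note D = sq_dist_gcrn[of d Om x y]
  have B: "limit_accept c (h * vnorm d (mvec d Om x)) (h * vnorm d (mvec d Om y))
           - 2 * (\<integral>z. \<bar>h\<^sup>2 * qform d Om z z / 2 - c\<bar> \<partial>gaussd d)
      \<le> (\<integral>w. both_accept d Om h x y w \<partial>?K)"
    using both_accept_gcrn[where d = d and Om = Om and h = h and x = x and y = y] min_accept_prob_approx[OF K, where Om = Om and h = h and x = x and y = y and c = c]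
      min_limit_accept_gcrn[where d = d and Om = Om and c = c and h = h and x = x and y = y, OF Om] by linarith
  have "s * (\<integral>w. both_accept d Om h x y w \<partial>?K) - (\<integral>z. ?E z \<partial>gaussd d) - h\<^sup>2 / 2 * (\<integral>w. ?D w \<partial>?K)
     = (\<integral>w. s * both_accept d Om h x y w - (?E (fst (snd w)) / 2 + ?E (snd (snd w)) / 2) - h\<^sup>2 / 2 * ?D w \<partial>?K)"
    using E BB D(1) by (simp add: Bochner_Integration.integral_diff Bochner_Integration.integral_add)
  also have "\<dots> \<le> (\<integral>w. cross_incr d Om h x y w \<partial>?K)"
  proof (rule integral_mono[OF _ integrable_cross_incr[OF K]])
    show "integrable ?K (\<lambda>w. s * both_accept d Om h x y w
        - (?E (fst (snd w)) / 2 + ?E (snd (snd w)) / 2) - h\<^sup>2 / 2 * ?D w)"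
      by (intro Bochner_Integration.integrable_add Bochner_Integration.integrable_diff
          integrable_mult_right integrable_divide E BB D)
    fix w :: "(real \<times> real) \<times> (nat \<Rightarrow> real) \<times> (nat \<Rightarrow> real)"
    let ?u = "fst (snd w)" and ?v = "snd (snd w)" and ?b = "both_accept d Om h x y w"
    let ?e = "?E ?u / 2 + ?E ?v / 2 + h\<^sup>2 / 2 * ?D w"
    have b: "0 \<le> ?b" "?b \<le> 1" by (auto simp: accept_bounds mult_le_one)
    have e: "0 \<le> ?e" by (intro add_nonneg_nonneg mult_nonneg_nonneg dotd_self_nonneg) auto
    have pol: "s + ((h\<^sup>2 * dotd d ?u ?u - s) / 2 + (h\<^sup>2 * dotd d ?v ?v - s) / 2) - h\<^sup>2 / 2 * ?D w
        = h\<^sup>2 * dotd d ?u ?v"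
      by (subst dotd_polarization[of d ?u ?v]) (simp add: field_simps)
    have "s - (\<bar>p\<bar> / 2 + \<bar>q\<bar> / 2 + r) \<le> s + (p / 2 + q / 2) - r" for p q r
      by linarith
    from this[of "h\<^sup>2 * dotd d ?u ?u - s" "h\<^sup>2 * dotd d ?v ?v - s" "h\<^sup>2 / 2 * ?D w"]
    have "s - ?e \<le> h\<^sup>2 * dotd d ?u ?v" unfolding pol .
    then have "(s - ?e) * ?b \<le> h\<^sup>2 * dotd d ?u ?v * ?b" by (rule mult_right_mono[OF _ b(1)])
    then have "s * ?b - ?e * ?b \<le> h\<^sup>2 * dotd d ?u ?v * ?b" by (simp only: left_diff_distrib)
    moreover have "?e * ?b \<le> ?e" by (rule mult_left_le[OF b(2) e])
    moreover have "A - (P + Q) - R \<le> Y" if "A - X \<le> Y" "X \<le> P + Q + R" for A P Q R X Y :: real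
      using that by linarith
    ultimately show "s * ?b - (?E ?u / 2 + ?E ?v / 2) - h\<^sup>2 / 2 * ?D w \<le> cross_incr d Om h x y w"
      unfolding cross_incr_eq by blast
  qed
  \<comment> \<open>The term \<open>8 * h^2\<close> is \<open>h^2 / 2\<close> times the bound 16 on
    the mean squared distance.\<close>
  finally show ?thesis
    using mult_left_mono[OF B s] mult_left_mono[OF D(2), of "h\<^sup>2 / 2"] by simp
qed

section \<open>Passage to the limit\<close>

text \<open>On a probability space the \<open>L_1\<close> norm is at most the \<open>L_2\<close>
  norm, so the assumed \<open>L_2\<close> convergence controls the errors of the two
  estimates.\<close>

lemma scaled_qform_L1_tendsto:
  fixes A :: "nat \<Rightarrow> nat \<Rightarrow> nat \<Rightarrow> real"
  assumes "(\<lambda>d. \<integral>Z. (qform d (A d) Z Z / real d - m)\<^sup>2 \<partial>gaussd d) \<longlonglongrightarrow> 0"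
  shows "(\<lambda>d. \<integral>Z. \<bar>(l / sqrt (real d))\<^sup>2 * qform d (A d) Z Z - l\<^sup>2 * m\<bar> \<partial>gaussd d) \<longlonglongrightarrow> 0"
proof (rule tendsto_sandwich[OF _ _ tendsto_const])
  let ?X = "\<lambda>d Z. qform d (A d) Z Z / real d - m"
  show "\<forall>\<^sub>F d in sequentially. 0 \<le> (\<integral>Z. \<bar>(l / sqrt (real d))\<^sup>2 * qform d (A d) Z Z - l\<^sup>2 * m\<bar> \<partial>gaussd d)"
    by (intro always_eventually allI integral_nonneg_AE) auto
  show "(\<lambda>d. l\<^sup>2 * sqrt (\<integral>Z. (?X d Z)\<^sup>2 \<partial>gaussd d)) \<longlonglongrightarrow> 0"
    using tendsto_mult_left[OF tendsto_real_sqrt[OF assms], of "l\<^sup>2"] by simp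
  have "(\<integral>Z. \<bar>(l / sqrt (real d))\<^sup>2 * qform d (A d) Z Z - l\<^sup>2 * m\<bar> \<partial>gaussd d)
      \<le> l\<^sup>2 * sqrt (\<integral>Z. (?X d Z)\<^sup>2 \<partial>gaussd d)" for d
  proof -
    interpret G: prob_space "gaussd d" by simp
    have m: "?X d \<in> borel_measurable (gaussd d)"
      by (intro borel_measurable_diff borel_measurable_divide measurable_quadratic) auto
    have sq: "integrable (gaussd d) (\<lambda>Z. (?X d Z)\<^sup>2)"
      unfolding power2_diff power_divide
      by (intro Bochner_Integration.integrable_diff Bochner_Integration.integrable_add integrable_divide
          integrable_mult_left integrable_mult_right integrable_qform integrable_qform_squared) auto
    \<comment> \<open>This includes \<open>d = 0\<close>, where both quotients by 0 are 0.\<close>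
    have "(l / sqrt (real d))\<^sup>2 * qform d (A d) Z Z - l\<^sup>2 * m = l\<^sup>2 * ?X d Z" for Z
      by (simp add: power_divide algebra_simps)
    then have "(\<integral>Z. \<bar>(l / sqrt (real d))\<^sup>2 * qform d (A d) Z Z - l\<^sup>2 * m\<bar> \<partial>gaussd d)
        = l\<^sup>2 * (\<integral>Z. \<bar>?X d Z\<bar> \<partial>gaussd d)"
      by (simp only: abs_mult abs_power2 integral_mult_right_zero)
    then show ?thesis
      using mult_left_mono[OF G.expectation_abs_le_sqrt[OF m sq], of "l\<^sup>2"] by simp
  qed
  then show "\<forall>\<^sub>F d in sequentially. (\<integral>Z. \<bar>(l / sqrt (real d))\<^sup>2 * qform d (A d) Z Z - l\<^sup>2 * m\<bar> \<partial>gaussd d)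
      \<le> l\<^sup>2 * sqrt (\<integral>Z. (?X d Z)\<^sup>2 \<partial>gaussd d)" by simp
qed

text \<open>The factor \<open>sqrt d\<close> of the gradient norm cancels against the step size. The
  identity is exact, so the scales in \<open>limit_accept\<close> do not move with
  \<open>d\<close>.\<close>

lemma step_times_gradient_norm:
  assumes "\<And>i j. i < d \<Longrightarrow> j < d \<Longrightarrow> A i j = A j i" and "0 < d" "0 < \<zeta>"
    and "qform d (mmul d A A) u u / (\<zeta>\<^sup>2 * real d) = r"
  shows "l / sqrt (real d) * vnorm d (mvec d A u) = l * \<zeta> * sqrt r"
proof -
  have "dotd d (mvec d A u) (mvec d A u) = r * (\<zeta>\<^sup>2 * real d)"
    using assms by (auto simp: qform_mmul_self)
  then show ?thesis
    using assms(2,3) by (simp add: vnorm_def real_sqrt_mult)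
qed

text \<open>Conditioning is expressed by arbitrary state sequences that carry the prescribed values
  for all large \<open>d\<close>; in small dimensions such states may not exist, for instance when
  \<open>d = 1\<close> and \<open>v1\<close> is strictly between the Cauchy-Schwarz bounds.\<close>

theorem theorem4:
  fixes Sig Om :: "nat \<Rightarrow> nat \<Rightarrow> nat \<Rightarrow> real"
    and z :: "int \<Rightarrow> real"
    and l x1 y1 v1 :: real
    and xs ys :: "nat \<Rightarrow> nat \<Rightarrow> real"
  assumes spd: "\<And>d. d \<ge> 1 \<Longrightarrow> sym_pos_def_mat d (Sig d)"
    and inv: "\<And>d. d \<ge> 1 \<Longrightarrow> inverse_mat d (Sig d) (Om d)"
    and z_pos: "\<And>k. z k > 0"
    and z_lim: "\<And>k. (\<lambda>d. \<integral>Z. (qform d (mpowi d (Sig d) (Om d) k) Z Z / real d - (z k)\<^sup>2)\<^sup>2 \<partial>gaussd d)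
                     \<longlonglongrightarrow> 0"
    and l_pos: "l > 0"
    and S: "x1 \<ge> 0" "y1 \<ge> 0" "\<bar>v1\<bar> \<le> sqrt (x1 * y1)"
    and state: "\<forall>\<^sub>F d in sequentially.
        qform d (mmul d (Om d) (Om d)) (xs d) (xs d) / ((z 1)\<^sup>2 * real d) = x1 \<and>
        qform d (mmul d (Om d) (Om d)) (ys d) (ys d) / ((z 1)\<^sup>2 * real d) = y1 \<and>
        qform d (mmul d (Om d) (Om d)) (xs d) (ys d) / ((z 1)\<^sup>2 * real d) = v1"
  shows "\<exists>L. (\<lambda>d. SUP K \<in> couplings_I d.
                  \<integral>w. cross_incr d (Om d) (l / sqrt (real d)) (xs d) (ys d) w \<partial>K) \<longlonglongrightarrow> L
          \<and> (\<lambda>d. \<integral>w. cross_incr d (Om d) (l / sqrt (real d)) (xs d) (ys d) w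
                  \<partial>gcrn_coupling d (Om d) (xs d) (ys d)) \<longlonglongrightarrow> L"
proof -
  \<comment> \<open>Here \<open>s\<close> is the \<open>L_1\<close> limit of \<open>h^2\<close>
    times the squared proposal norm (exponent 0) and \<open>c\<close> that of half of
    \<open>h^2\<close> times its \<open>Om\<close>-norm squared (exponent 1), while \<open>a\<close>
    and \<open>b\<close> are the scales of the linear parts.\<close>
  define s c a b where "s = l\<^sup>2 * (z 0)\<^sup>2" and "c = l\<^sup>2 * (z 1)\<^sup>2 / 2"
    and "a = l * z 1 * sqrt x1" and "b = l * z 1 * sqrt y1"
  define h where "h d = l / sqrt (real d)" for d :: nat
  define e0 where "e0 d = (\<integral>Z. \<bar>(h d)\<^sup>2 * dotd d Z Z - s\<bar> \<partial>gaussd d)" for d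
  define e1 where "e1 d = (\<integral>Z. \<bar>(h d)\<^sup>2 * qform d (Om d) Z Z / 2 - c\<bar> \<partial>gaussd d)" for d
  define up where "up d = s * (limit_accept c a b + 2 * e1 d) + e0 d" for d
  define lo where "lo d = s * (limit_accept c a b - 2 * e1 d) - e0 d - 8 * (h d)\<^sup>2" for d
  let ?G = "\<lambda>d. \<integral>w. cross_incr d (Om d) (h d) (xs d) (ys d) w \<partial>gcrn_coupling d (Om d) (xs d) (ys d)"
  let ?S = "\<lambda>d. SUP K \<in> couplings_I d. \<integral>w. cross_incr d (Om d) (h d) (xs d) (ys d) w \<partial>K"
  have s: "0 \<le> s" by (simp add: s_def)
  have h: "0 \<le> h d" for d using l_pos by (simp add: h_def)
  have lim_e0: "e0 \<longlonglongrightarrow> 0"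
    using scaled_qform_L1_tendsto[OF z_lim[of 0], of l]
    by (simp only: qform_mpowi_0 e0_def[abs_def] h_def s_def)
  have lim_e1: "e1 \<longlonglongrightarrow> 0"
  proof -
    have "e1 d = (\<integral>Z. \<bar>(l / sqrt (real d))\<^sup>2 * qform d (Om d) Z Z - l\<^sup>2 * (z 1)\<^sup>2\<bar> \<partial>gaussd d) / 2" for d
      unfolding e1_def h_def c_def diff_divide_distrib[symmetric] abs_divide by simp
    then have "e1 = (\<lambda>d. (\<integral>Z. \<bar>(l / sqrt (real d))\<^sup>2 * qform d (Om d) Z Z - l\<^sup>2 * (z 1)\<^sup>2\<bar> \<partial>gaussd d) / 2)"
      by (rule ext)
    then show ?thesis
      using tendsto_divide[OF scaled_qform_L1_tendsto[OF z_lim[of 1], of l] tendsto_const[of 2]]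
      by (simp add: qform_mpowi_1)
  qed
  have lim_h: "h \<longlonglongrightarrow> 0"
    unfolding h_def by real_asymp
  have "up \<longlonglongrightarrow> s * (limit_accept c a b + 2 * 0) + 0"
      "lo \<longlonglongrightarrow> s * (limit_accept c a b - 2 * 0) - 0 - 8 * 0\<^sup>2"
    unfolding up_def[abs_def] lo_def[abs_def] by (intro tendsto_intros lim_e0 lim_e1 lim_h)+
  then have lim: "up \<longlonglongrightarrow> s * limit_accept c a b" "lo \<longlonglongrightarrow> s * limit_accept c a b" by simp_all
  \<comment> \<open>Both outer bounds tend to \<open>s * limit_accept c a b\<close>, which squeezes
    the GCRN value and the supremum together.\<close>
  have "\<forall>\<^sub>F d in sequentially. lo d \<le> ?G d \<and> ?G d \<le> ?S d \<and> ?S d \<le> up d"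
    using state eventually_gt_at_top[of 0]
  proof eventually_elim
    case (elim d)
    then have d: "0 < d" "1 \<le> d" by auto
    have Om: "Om d i j = Om d j i" if "i < d" "j < d" for i j
      using inverse_mat_symmetric[OF spd inv that] d by simp
    have ab: "h d * vnorm d (mvec d (Om d) (xs d)) = a" "h d * vnorm d (mvec d (Om d) (ys d)) = b"
      using elim step_times_gradient_norm[where A = "Om d" and d = d, OF Om d(1) z_pos[of 1]] by (auto simp: h_def a_def b_def)
    have ub: "(\<integral>w. cross_incr d (Om d) (h d) (xs d) (ys d) w \<partial>K) \<le> up d" if "K \<in> couplings_I d" for K
      using cross_incr_upper[where Om = "Om d" and h = "h d" and c = c and x = "xs d" and y = "ys d", OF that h s Om] by (simp add: ab up_def e0_def e1_def)
    have "lo d \<le> ?G d"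
      using cross_incr_gcrn_lower[where Om = "Om d" and d = d and c = c and h = "h d" and x = "xs d" and y = "ys d", OF s Om] by (simp add: ab lo_def e0_def e1_def)
    \<comment> \<open>A real supremum dominates its members only over a set bounded above;
      \<open>up d\<close> is such a bound because it does not depend on the coupling.\<close>
    moreover have "?G d \<le> ?S d"
      by (intro cSUP_upper gcrn_coupling_in_couplings_I bdd_aboveI2[where M = "up d"] ub)
    moreover have "?S d \<le> up d"
      by (rule cSUP_least[OF _ ub]) (use gcrn_coupling_in_couplings_I in blast)
    ultimately show ?case by blast
  qed
  then have ev: "\<forall>\<^sub>F d in sequentially. lo d \<le> ?G d" "\<forall>\<^sub>F d in sequentially. ?G d \<le> up d"
    "\<forall>\<^sub>F d in sequentially. lo d \<le> ?S d" "\<forall>\<^sub>F d in sequentially. ?S d \<le> up d"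
    by (eventually_elim, linarith)+
  have "?S \<longlonglongrightarrow> s * limit_accept c a b" "?G \<longlonglongrightarrow> s * limit_accept c a b"
    by (rule tendsto_sandwich[OF ev(3,4) lim(2,1)], rule tendsto_sandwich[OF ev(1,2) lim(2,1)])
  then show ?thesis unfolding h_def by blast
qed

end
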